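(* Let $V:\mathbb R^d\to[0,\infty]$ have a unique minimum at the origin and satisfy: (i) $V(x)=\|x\|^\delta(1+o(1))$ as $x\to0$, with $0<\delta<d$; (ii) there is $b>0$ such that $V(x)>b$ for all $\|x\|>1$; (iii) for every $a>0$ there is a constant $C_a$ (independent of $L$) such that $$\frac1{L^d}\sum_{x\in\mathbb Z^d\setminus\{0\}}e^{-aV(x/L)}<C_a\int_{\mathbb R^d}e^{-aV(x)}dx<\infty,$$ and the left side converges to $\int_{\mathbb R^d}e^{-aV(x)}dx$ as $L\to\infty$. Let the weights satisfy $\theta_j>0$ for all $j$, $\lim_{j\to\infty}\frac1j\log\theta_j=0$, and $\sum_{j\ge1}\theta_j\,j^{-d/\delta}<\infty$. Suppose that there exist constants $C,c\ge0$ and $a\le\frac12\bigl(1-\frac\delta d\bigr)$ such that for all $n\ge1$, $$C^{-1}e^{-cn^a}\le h_n\le C\,e^{cn^a}.$$ Assume also that $\rho>\rho_{\rm c}$. Then, as $n,L\to\infty$ with fixed $\rho=n/L^d$, under $\mathbb P_{L,n}$, $$\frac1{L^d}H_0\longrightarrow\rho-\rho_{\rm c}\quad\text{in distribution}.$$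
   Context: A spatial partition of $n$ is a family $\boldsymbol\lambda=(\lambda_x)_{x\in\mathbb Z^d}$ of integer partitions (possibly empty) whose parts sum in total to $n$; $\Lambda_n$ is the set of these. $r_{xj}(\boldsymbol\lambda)$ is the number of parts of $\lambda_x$ equal to $j$; $H_x=\sum_jj\,r_{xj}$ is the occupation of site $x$, so $H_0$ is the occupation of the origin. The probability measure on $\Lambda_n$ is $$\mathbb P_{L,n}(\boldsymbol\lambda)=\frac1{Z_{L,n}}\prod_{x\in\mathbb Z^d}\prod_{j\ge1}\frac1{r_{xj}(\boldsymbol\lambda)!}\Bigl(\frac{\theta_j}{j}e^{-jV(x/L)}\Bigr)^{r_{xj}(\boldsymbol\lambda)},$$ with normalization $Z_{L,n}$ (assumed finite), and $e^{-\infty}=0$, $0^0=1$. The numbers $h_m$ are given by $\sum_{m\ge0}h_mz^m=\exp\bigl(\sum_{j\ge1}\frac{\theta_j}{j}z^j\bigr)$ (formal power series; $h_0=1$). The transition density is $\rho_{\rm c}=\sum_{j\ge1}\theta_j\int_{\mathbb R^d}e^{-jV(x)}dx$, which is finite when $V:\mathbb R^d\to[0,\infty]$ has a unique minimum at the origin, $V(x)=\|x\|^\delta(1+o(1))$ as $x\to0$ with $0<\delta<d$, $V(x)>b>0$ for all $\|x\|>1$, for every $a>0$ there is a constant $C_a$ (independent of $L$) such that $\frac1{L^d}\sum_{x\in\mathbb Z^d\setminus\{0\}}e^{-aV(x/L)}<C_a\int_{\mathbb R^d}e^{-aV(x)}dx<\infty$ with the left side converging to $\int_{\mathbb R^d}e^{-aV(x)}dx$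 as $L\to\infty$, and the weights satisfy $\theta_j>0$ for all $j$, $\lim_{j\to\infty}\frac1j\log\theta_j=0$ and $\sum_{j\ge1}\theta_j\,j^{-d/\delta}<\infty$. $\|\cdot\|$ is the Euclidean norm.
   Formalization: "Unique minimum at the origin" is taken to mean V(0) < inf of V over ‖x‖≥ε for every ε>0 (automatic for lower semicontinuous V); with only V(0)<V(x) for x≠0 the claim fails, e.g. d=1, V(x)=exp(-1/|x-1/2|) near 1/2 with V(1/2)=1. *)

theory Defs
  imports
    "HOL-Probability.Probability"
    "HOL-Computational_Algebra.Formal_Power_Series"
    "HOL-Library.Multiset"
begin

text \<open>
  The lattice and the space are \<open>int ^ 'd\<close> and \<open>real ^ 'd\<close>, with dimension \<open>CARD('d)\<close>.
  An integer partition is the multiset of its (positive) parts.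
\<close>

type_synonym 'd spatial_partition = "int ^ 'd \<Rightarrow> nat multiset"

definition spatial_partitions :: "nat \<Rightarrow> ('d::finite) spatial_partition set" where
  "spatial_partitions n =
     {lam. (\<forall>x. 0 \<notin># lam x) \<and> finite {x. lam x \<noteq> {#}} \<and>
         (\<Sum>x\<in>{x. lam x \<noteq> {#}}. \<Sum>\<^sub># (lam x)) = n}"

definition mult_part :: "('d::finite) spatial_partition \<Rightarrow> int ^ 'd \<Rightarrow> nat \<Rightarrow> nat" where
  "mult_part lam x j = count (lam x) j"

definition occupation :: "('d::finite) spatial_partition \<Rightarrow> int ^ 'd \<Rightarrow> nat" where
  "occupation lam x = (\<Sum>j\<in>set_mset (lam x). j * mult_part lam x j)"

definition exp_neg :: "ennreal \<Rightarrow> real" where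
  "exp_neg v = (if v = \<infinity> then 0 else exp (- enn2real v))"

definition lattice_point :: "int ^ 'd \<Rightarrow> real ^ ('d::finite)" where
  "lattice_point x = (\<chi> i. real_of_int (x $ i))"

text \<open>
  Only the finitely many factors with nonzero multiplicity are written; the remaining
  factors of the product over all sites and all part sizes are \<open>1\<close> (with \<open>0\<^sup>0 = 1\<close>).
\<close>

definition weight ::
  "(nat \<Rightarrow> real) \<Rightarrow> (real ^ 'd \<Rightarrow> ennreal) \<Rightarrow> real \<Rightarrow> ('d::finite) spatial_partition \<Rightarrow> real" where
  "weight \<theta> V L lam =
     (\<Prod>x\<in>{x. lam x \<noteq> {#}}. \<Prod>j\<in>set_mset (lam x).
        1 / fact (mult_part lam x j) *
        (\<theta> j / real j * exp_neg (of_nat j * V (lattice_point x /\<^sub>R L))) ^ mult_part lam x j)"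

definition partition_fun ::
  "(nat \<Rightarrow> real) \<Rightarrow> (real ^ 'd \<Rightarrow> ennreal) \<Rightarrow> real \<Rightarrow> nat \<Rightarrow> real" where
  "partition_fun \<theta> V L n = (\<Sum>\<^sub>\<infinity>lam\<in>spatial_partitions n. weight \<theta> V L (lam :: ('d::finite) spatial_partition))"

definition partition_measure ::
  "(nat \<Rightarrow> real) \<Rightarrow> (real ^ 'd \<Rightarrow> ennreal) \<Rightarrow> real \<Rightarrow> nat \<Rightarrow> ('d::finite) spatial_partition measure" where
  "partition_measure \<theta> V L n =
     point_measure (spatial_partitions n) (\<lambda>lam. ennreal (weight \<theta> V L lam / partition_fun \<theta> V L n))"

definition h_coeff :: "(nat \<Rightarrow> real) \<Rightarrow> nat \<Rightarrow> real" where
  "h_coeff \<theta> m =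
     fps_nth (fps_compose (fps_exp 1) (Abs_fps (\<lambda>j. if j = 0 then 0 else \<theta> j / real j))) m"

definition boltzmann_integral :: "(real ^ ('d::finite) \<Rightarrow> ennreal) \<Rightarrow> real \<Rightarrow> real" where
  "boltzmann_integral V a = (\<integral>x. exp_neg (ennreal a * V x) \<partial>lebesgue)"

definition lattice_average :: "(real ^ ('d::finite) \<Rightarrow> ennreal) \<Rightarrow> real \<Rightarrow> real \<Rightarrow> real" where
  "lattice_average V a L =
     1 / L ^ CARD('d) * (\<Sum>\<^sub>\<infinity>x\<in>- {0}. exp_neg (ennreal a * V (lattice_point x /\<^sub>R L)))"

definition critical_density :: "(nat \<Rightarrow> real) \<Rightarrow> (real ^ ('d::finite) \<Rightarrow> ennreal) \<Rightarrow> real" where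
  "critical_density \<theta> V = (\<Sum>\<^sub>\<infinity>j\<in>{1..}. \<theta> j * boltzmann_integral V (real j))"

text \<open>
  A unique minimum at the origin: no value near the minimum occurs away from the origin.
  For lower semicontinuous \<open>V\<close> that is bounded below by some \<open>b > V 0\<close> outside the
  unit ball this is the same as \<open>V 0 < V x\<close> for all \<open>x \<noteq> 0\<close>.  Without any regularity of \<open>V\<close>
  the pointwise condition would be too weak: values of \<open>V\<close> could accumulate at \<open>V 0\<close>
  near a point other than the origin.
\<close>

definition unique_min_at_origin :: "(real ^ ('d::finite) \<Rightarrow> ennreal) \<Rightarrow> bool" where
  "unique_min_at_origin V \<longleftrightarrow> (\<forall>\<epsilon>>0. V 0 < (INF x\<in>{x. \<epsilon> \<le> norm x}. V x))"

end

theory Submission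
  imports Defs "HOL-Real_Asymp.Real_Asymp"
begin

text \<open>
  Write \<open>N = L\<^sup>d\<close>.  A minimum at the origin together with \<open>V x \<sim> \<parallel>x\<parallel>\<^sup>\<delta>\<close> forces \<open>V 0 = 0\<close>, so the
  partition at the origin carries the weight \<open>\<Prod>j. (\<theta>\<^sub>j/j)\<^bsup>r\<^esup>/r!\<close>, and the total weight of all its
  configurations of size \<open>m\<close> is \<open>h\<^sub>m\<close> (\<open>h_coeff_eq_parts_sum\<close>).  The rest of the configuration is
  a finite multiset \<open>M\<close> of cells \<open>(x, j)\<close> with \<open>x \<noteq> 0\<close>, whose weight \<open>W M\<close> is the unnormalised law of
  independent Poisson variables: a gas in which the origin is absent.  Summing
  out the origin (\<open>has_sum_weight_occupation\<close>), the event \<open>H\<^sub>0 \<in> Q\<close> has weight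
  \<open>\<Sum>M. h\<^bsub>n - total M\<^esub> * W M\<close>, where \<open>M\<close> is restricted by \<open>n - total M \<in> Q\<close>.  Hence the claim is that
  \<open>total M / N\<close> concentrates at \<open>\<rho>\<^sub>c\<close> so strongly that the factors \<open>h\<close>, which
  lie between \<open>exp (- c m\<^sup>a)\<close> and \<open>exp (c m\<^sup>a)\<close> up to a constant for the index \<open>m\<close>, cannot matter.

  Concentration is a Chernoff bound.  By the exponential formula (\<open>has_sum_mset_weight\<close>) the generating
  function \<open>\<Sum>M. W M * exp (\<tau> * total M)\<close> is the exponential of an explicit series over the cells.
  The tilt \<open>\<tau>\<close> has to respect the lattice spacing: off the origin \<open>V (x/L) \<ge> \<kappa> L\<^bsup>-\<delta>\<^esup>\<close>, so a tilt
  \<open>\<bar>\<tau>\<bar> \<le> \<kappa> L\<^bsup>-\<delta>\<^esup> / 2\<close> costs at most half of the potential.  What is left is dominated, uniformly in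
  \<open>L\<close>, by the summable sequence \<open>\<theta>\<^sub>j (j\<^bsup>-d/\<delta>\<^esup> + exp (- \<kappa> j / 2))\<close>, up to constants
  (\<open>dominated_lattice_sums\<close>).  With \<open>\<bar>\<tau>\<bar> = L\<^bsup>-\<gamma>\<^esup>\<close> for some \<open>\<gamma> > \<delta>\<close>, Tannery's theorem yields that the logarithm of
  the generating function changes by \<open>\<tau> N (\<rho>\<^sub>c + o(1))\<close> (\<open>log_partition_difference\<close>), and
  a deviation of \<open>total M / N\<close> from \<open>\<rho>\<^sub>c\<close> by a fixed amount has weight at most
  \<open>exp (- \<eta> L\<^bsup>d - \<gamma>\<^esup>)\<close> relative to the whole (\<open>total_tail_bound\<close>).

  The bound on \<open>a\<close> gives \<open>n\<^sup>a = O (L\<^bsup>(d - \<delta>)/2\<^esup>)\<close>, while \<open>\<gamma> = \<delta> + (d - \<delta>)/4\<close> makes the gain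
  \<open>L\<^bsup>3(d - \<delta>)/4\<^esup>\<close>, which wins.  As \<open>\<rho> > \<rho>\<^sub>c\<close>, the constraint \<open>total M \<le> n\<close> keeps at least
  half of the weight of the gas, so the normalisation is not small either
  (\<open>partition_fun_lower_bound\<close>).  Thus \<open>H\<^sub>0 / N = \<rho> - total M / N\<close> tends to \<open>\<rho> - \<rho>\<^sub>c\<close>.
\<close>

section \<open>Sums over multisets\<close>

text \<open>
  Up to the factor \<open>exp (- \<Sum>i. w i)\<close> this is the probability that independent Poisson variables
  with means \<open>w i\<close> take the values \<open>count M i\<close>.
\<close>
definition mset_weight :: "('a \<Rightarrow> real) \<Rightarrow> 'a multiset \<Rightarrow> real" where
  "mset_weight w M = (\<Prod>i\<in>set_mset M. w i ^ count M i / fact (count M i))"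

lemma mset_weight_superset:
  assumes "finite A" "set_mset M \<subseteq> A"
  shows "mset_weight w M = (\<Prod>i\<in>A. w i ^ count M i / fact (count M i))"
  unfolding mset_weight_def
  by (rule prod.mono_neutral_left) (use assms in \<open>auto simp: not_in_iff\<close>)

lemma mset_weight_nonneg:
  assumes "\<And>i. i \<in># M \<Longrightarrow> w i \<ge> 0"
  shows "mset_weight w M \<ge> 0"
  unfolding mset_weight_def by (intro prod_nonneg) (use assms in auto)

lemma mset_weight_empty [simp]: "mset_weight w {#} = 1"
  by (simp add: mset_weight_def)

lemma mset_weight_add_replicate:
  assumes "i \<notin># M"
  shows "mset_weight w (M + replicate_mset k i) = mset_weight w M * (w i ^ k / fact k)"
proof -
  let ?N = "M + replicate_mset k i"
  have "mset_weight w ?N = (\<Prod>j\<in>insert i (set_mset M). w j ^ count ?N j / fact (count ?N j))"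
    by (rule mset_weight_superset) (auto split: if_splits)
  also have "\<dots> = (w i ^ k / fact k) * (\<Prod>j\<in>set_mset M. w j ^ count ?N j / fact (count ?N j))"
    using assms by (subst prod.insert) (auto simp: not_in_iff)
  also have "(\<Prod>j\<in>set_mset M. w j ^ count ?N j / fact (count ?N j)) = mset_weight w M"
    unfolding mset_weight_def by (intro prod.cong) (use assms in auto)
  finally show ?thesis by simp
qed

lemma sum_mset_superset:
  fixes f :: "'a \<Rightarrow> 'b::comm_semiring_1"
  assumes "finite A" "set_mset M \<subseteq> A"
  shows "(\<Sum>i\<in>#M. f i) = (\<Sum>i\<in>A. of_nat (count M i) * f i)"
  using assms(2)
proof (induction M)
  case (add x M)
  have "(\<Sum>i\<in>A. of_nat (count (add_mset x M) i) * f i)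
      = (\<Sum>i\<in>A. of_nat (count M i) * f i + (if i = x then f i else 0))"
    by (intro sum.cong refl) (auto simp: algebra_simps)
  also have "\<dots> = (\<Sum>i\<in>A. of_nat (count M i) * f i) + f x"
    using add.prems assms(1) by (simp add: sum.distrib)
  finally show ?case using add by (simp add: add.commute)
qed simp

text \<open>
  Exponential tilting of the weights is the same as weighting each multiset by an additive
  functional; this turns moment generating functions into sums of the same kind.
\<close>
lemma mset_weight_tilt:
  "mset_weight (\<lambda>i. w i * exp (t * f i)) M = mset_weight w M * exp (t * (\<Sum>i\<in>#M. f i))"
proof -
  have "mset_weight (\<lambda>i. w i * exp (t * f i)) M =
      mset_weight w M * (\<Prod>i\<in>set_mset M. exp (t * (real (count M i) * f i)))"
    unfolding mset_weight_def
    by (simp add: power_mult_distrib exp_of_nat_mult[symmetric] mult_ac flip: prod.distrib)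
  also have "(\<Prod>i\<in>set_mset M. exp (t * (real (count M i) * f i))) = exp (t * (\<Sum>i\<in>#M. f i))"
    by (simp add: sum_mset_superset[of "set_mset M" M f] exp_sum[symmetric] sum_distrib_left)
  finally show ?thesis .
qed

lemma has_sum_exp_series:
  fixes x :: real assumes "x \<ge> 0"
  shows "((\<lambda>k. x ^ k / fact k) has_sum exp x) UNIV"
  using exp_converges[of x] assms
  by (intro sums_nonneg_imp_has_sum) (auto simp: field_simps)

text \<open>
  A multiset over \<open>insert i J\<close> is a multiset over \<open>J\<close> together with a multiplicity of \<open>i\<close>, so that
  each new element contributes one exponential series as a factor.
\<close>
lemma has_sum_mset_weight_finite:
  assumes "finite J" "\<And>i. i \<in> J \<Longrightarrow> w i \<ge> 0"
  shows "(mset_weight w has_sum exp (\<Sum>i\<in>J. w i)) {M. set_mset M \<subseteq> J}"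
  using assms
proof (induction J rule: finite_induct)
  case empty
  have "{M :: 'a multiset. set_mset M \<subseteq> {}} = {{#}}" by auto
  then show ?case by (auto intro!: has_sum_finiteI)
next
  case (insert i J)
  define h where "h = (\<lambda>(M :: 'a multiset, k). M + replicate_mset k i)"
  let ?A = "{M. set_mset M \<subseteq> J}"
  have img: "{M. set_mset M \<subseteq> insert i J} = h ` (?A \<times> UNIV)"
  proof (intro set_eqI iffI)
    fix M :: "'a multiset" assume M: "M \<in> {M. set_mset M \<subseteq> insert i J}"
    have "M = h (filter_mset (\<lambda>x. x \<noteq> i) M, count M i)"
      by (auto simp: h_def multiset_eq_iff)
    moreover have "filter_mset (\<lambda>x. x \<noteq> i) M \<in> ?A" using M by auto
    ultimately show "M \<in> h ` (?A \<times> UNIV)" by blast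
  qed (auto simp: h_def split: if_splits)
  have inj: "inj_on h (?A \<times> UNIV)"
  proof (rule inj_onI, clarsimp simp: h_def)
    fix M M' k k' assume M: "set_mset M \<subseteq> J" "set_mset M' \<subseteq> J"
      and e: "M + replicate_mset k i = M' + replicate_mset k' i"
    have "count M i = 0" "count M' i = 0" using M insert.hyps by (auto simp: count_eq_zero_iff)
    then have "k = k'" using e by (metis add_left_cancel count_replicate_mset count_union)
    then show "M = M' \<and> k = k'" using e by simp
  qed
  have wt: "mset_weight w (h (M, k)) = mset_weight w M * (w i ^ k / fact k)" if "M \<in> ?A" for M k
    unfolding h_def prod.case by (rule mset_weight_add_replicate) (use that insert.hyps in auto)
  have inner: "((\<lambda>k. mset_weight w (h (M, k))) has_sum (mset_weight w M * exp (w i))) UNIV"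
    if "M \<in> ?A" for M
    using has_sum_cmult_right[OF has_sum_exp_series[of "w i"], of "mset_weight w M"] insert.prems
    by (simp add: wt[OF that])
  have outer: "((\<lambda>M. mset_weight w M * exp (w i)) has_sum (exp (\<Sum>i\<in>J. w i) * exp (w i))) ?A"
    by (intro has_sum_cmult_left insert.IH) (use insert.prems in auto)
  have "((\<lambda>p. mset_weight w (h p)) has_sum (exp (\<Sum>i\<in>J. w i) * exp (w i))) (?A \<times> UNIV)"
  proof (rule has_sum_SigmaI)
    show "(\<lambda>p. mset_weight w (h p)) summable_on ?A \<times> UNIV"
    proof (rule summable_on_SigmaI[OF inner])
      show "(\<lambda>M. mset_weight w M * exp (w i)) summable_on ?A"
        using outer by (auto simp: summable_on_def)
      show "mset_weight w (h (M, k)) \<ge> 0" if "M \<in> ?A" for M k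
        by (rule mset_weight_nonneg) (use that insert.prems in \<open>auto simp: h_def split: if_splits\<close>)
    qed
  qed (use inner outer in auto)
  then have "(mset_weight w has_sum (exp (\<Sum>i\<in>J. w i) * exp (w i))) (h ` (?A \<times> UNIV))"
    by (subst has_sum_reindex[OF inj]) (simp add: o_def)
  then show ?case using insert.hyps by (simp add: img exp_add mult.commute)
qed

text \<open>
  The exponential formula for infinitely many letters.  Finitely many multisets involve only
  finitely many letters, so both sides are suprema of their finite versions.
\<close>
lemma has_sum_mset_weight:
  assumes w: "w summable_on I" and nn: "\<And>i. i \<in> I \<Longrightarrow> w i \<ge> 0"
  shows "(mset_weight w has_sum exp (infsum w I)) {M. set_mset M \<subseteq> I}"
proof -
  let ?A = "{M. set_mset M \<subseteq> I}"
  have nnW: "mset_weight w M \<ge> 0" if "M \<in> ?A" for M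
    by (rule mset_weight_nonneg) (use that nn in auto)
  have fin: "sum (mset_weight w) F \<le> exp (infsum w I)" if F: "finite F" "F \<subseteq> ?A" for F
  proof -
    define J where "J = (\<Union>M\<in>F. set_mset M)"
    have J: "finite J" "J \<subseteq> I" using F by (auto simp: J_def)
    have "sum (mset_weight w) F \<le> exp (\<Sum>i\<in>J. w i)"
      by (rule finite_sum_le_has_sum[OF has_sum_mset_weight_finite])
         (use J F nn nnW in \<open>auto simp: J_def\<close>)
    also have "(\<Sum>i\<in>J. w i) \<le> infsum w I"
      by (rule finite_sum_le_infsum) (use w J nn in auto)
    finally show ?thesis by simp
  qed
  have summ: "mset_weight w summable_on ?A"
    by (rule nonneg_bdd_above_summable_on) (use nnW fin in \<open>auto intro!: bdd_aboveI2[where M = "exp (infsum w I)"]\<close>)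
  have le: "infsum (mset_weight w) ?A \<le> exp (infsum w I)"
    by (rule infsum_le_finite_sums[OF summ]) (use fin in auto)
  have "exp (sum w J) \<le> infsum (mset_weight w) ?A" if J: "finite J" "J \<subseteq> I" for J
    by (rule has_sum_mono'[OF has_sum_mset_weight_finite has_sum_infsum[OF summ]])
       (use J nn nnW in auto)
  then have *: "sum w J \<le> ln (infsum (mset_weight w) ?A)" if "finite J" "J \<subseteq> I" for J
    using that by (metis exp_gt_zero less_le_trans ln_exp ln_le_cancel_iff)
  have pos: "infsum (mset_weight w) ?A > 0"
    using \<open>\<And>J. _ \<Longrightarrow> _ \<Longrightarrow> exp (sum w J) \<le> _\<close>[of "{}"] by simp
  have "infsum w I \<le> ln (infsum (mset_weight w) ?A)"
    by (rule infsum_le_finite_sums[OF w]) (use * in auto)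
  then have "exp (infsum w I) \<le> infsum (mset_weight w) ?A"
    using pos by (metis exp_le_cancel_iff exp_ln)
  with le summ show ?thesis by (simp add: has_sum_iff)
qed

text \<open>
  Chernoff's bound.  The sign of \<open>t\<close> is free: \<open>t > 0\<close> bounds the upper tail of the functional
  \<open>\<Sum>i\<in>#M. f i\<close>, and \<open>t < 0\<close> the lower one.
\<close>
lemma mset_weight_tail_bound:
  assumes nn: "\<And>i. i \<in> I \<Longrightarrow> w i \<ge> 0"
    and w: "w summable_on I"
    and tilted: "(\<lambda>i. w i * exp (t * f i)) summable_on I"
    and S: "S \<subseteq> {M. set_mset M \<subseteq> I}" "\<And>M. M \<in> S \<Longrightarrow> t * y \<le> t * (\<Sum>i\<in>#M. f i)"
  shows "infsum (mset_weight w) S \<le> exp (- t * y) * exp (\<Sum>\<^sub>\<infinity>i\<in>I. w i * exp (t * f i))"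
proof -
  let ?A = "{M. set_mset M \<subseteq> I}"
  let ?w = "\<lambda>i. w i * exp (t * f i)"
  have hs: "(mset_weight ?w has_sum exp (infsum ?w I)) ?A"
    by (rule has_sum_mset_weight[OF tilted]) (use nn in auto)
  have nnW: "mset_weight w M \<ge> 0" if "M \<in> ?A" for M
    by (rule mset_weight_nonneg) (use that nn in auto)
  have "infsum (mset_weight w) S \<le> infsum (\<lambda>M. exp (- t * y) * mset_weight ?w M) ?A"
  proof (rule infsum_mono_neutral)
    show "mset_weight w summable_on S"
      using has_sum_mset_weight[OF w nn] S(1) summable_on_def summable_on_subset by blast
    show "(\<lambda>M. exp (- t * y) * mset_weight ?w M) summable_on ?A"
      using hs by (intro summable_on_cmult_right) (auto simp: summable_on_def)
    show "exp (- t * y) * mset_weight ?w M \<ge> 0" if "M \<in> ?A - S" for M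
      using nnW that by (simp add: mset_weight_tilt)
    show "mset_weight w M \<le> exp (- t * y) * mset_weight ?w M" if M: "M \<in> S \<inter> ?A" for M
    proof -
      have "mset_weight w M * 1 \<le> mset_weight w M * exp (t * (\<Sum>i\<in>#M. f i) - t * y)"
        by (rule mult_left_mono) (use M S nnW in auto)
      then show ?thesis by (simp add: mset_weight_tilt exp_diff exp_minus field_simps)
    qed
  qed (use S in auto)
  also have "\<dots> = exp (- t * y) * exp (infsum ?w I)"
    using hs by (simp add: infsum_cmult_right' infsumI)
  finally show ?thesis .
qed

section \<open>The numbers \<open>h\<close> as sums over partitions\<close>

definition parts_of :: "nat \<Rightarrow> nat multiset set" where
  "parts_of m = {P. 0 \<notin># P \<and> \<Sum>\<^sub># P = m}"

lemma finite_parts_of: "finite (parts_of m)"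
proof -
  have "parts_of m \<subseteq> mset ` {xs. set xs \<subseteq> {..m} \<and> length xs \<le> m}"
  proof
    fix P assume P: "P \<in> parts_of m"
    obtain xs where xs: "mset xs = P" using ex_mset by blast
    have P': "0 \<notin> set xs" "sum_list xs = m" using P xs by (auto simp: parts_of_def sum_mset_sum_list)
    have "set xs \<subseteq> {..m}" using P'(2) member_le_sum_list by auto
    moreover have "length xs \<le> m"
      using P'(1) unfolding P'(2)[symmetric] by (induction xs) auto
    ultimately show "P \<in> mset ` {xs. set xs \<subseteq> {..m} \<and> length xs \<le> m}" using xs by blast
  qed
  then show ?thesis by (rule finite_subset) (intro finite_imageI finite_lists_length_le, simp)
qed

definition parts_sum :: "(nat \<Rightarrow> real) \<Rightarrow> nat \<Rightarrow> real" where
  "parts_sum \<theta> m = (\<Sum>P\<in>parts_of m. mset_weight (\<lambda>j. \<theta> j / real j) P)"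

lemma mset_weight_remove1:
  assumes "i \<in># M"
  shows "real (count M i) * mset_weight w M = w i * mset_weight w (M - {#i#})"
proof -
  let ?g = "\<lambda>N j. w j ^ count N j / fact (count N j)"
  obtain k where k: "count M i = Suc k"
    using assms by (metis count_greater_zero_iff gr0_conv_Suc)
  have 1: "mset_weight w M = ?g M i * (\<Prod>j\<in>set_mset M - {i}. ?g M j)"
    unfolding mset_weight_def using assms by (subst prod.remove[of _ i]) auto
  have "mset_weight w (M - {#i#}) = (\<Prod>j\<in>set_mset M. ?g (M - {#i#}) j)"
    by (rule mset_weight_superset) (auto dest: in_diffD)
  also have "\<dots> = ?g (M - {#i#}) i * (\<Prod>j\<in>set_mset M - {i}. ?g M j)"
    using assms by (subst prod.remove[of _ i]) (auto intro!: prod.cong)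
  finally have 2: "mset_weight w (M - {#i#}) = w i ^ k / fact k * (\<Prod>j\<in>set_mset M - {i}. ?g M j)"
    using k by simp
  show ?thesis unfolding 1 2 k by (simp add: divide_simps)
qed

text \<open>
  Counting the size \<open>m\<close> of a partition as the sum of \<open>j\<close> times the multiplicity of \<open>j\<close> and then
  removing one part \<open>j\<close> gives the recursion that the logarithmic derivative gives
  for the coefficients of \<open>exp (\<Sum>j. \<theta>\<^sub>j z\<^sup>j / j)\<close>.
\<close>
lemma parts_sum_rec:
  "real m * parts_sum \<theta> m = (\<Sum>j=1..m. \<theta> j * parts_sum \<theta> (m - j))"
proof -
  let ?W = "mset_weight (\<lambda>j. \<theta> j / real j)"
  have sm: "real (\<Sum>\<^sub># P) = (\<Sum>j=1..m. real (count P j) * real j)" if P: "P \<in> parts_of m" for P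
  proof -
    have "set_mset P \<subseteq> {1..m}"
    proof
      fix j assume j: "j \<in># P"
      then have "j \<le> \<Sum>\<^sub># P" by (simp add: sum_mset.remove)
      moreover have "j \<noteq> 0" using j P by (metis (mono_tags) parts_of_def mem_Collect_eq)
      ultimately show "j \<in> {1..m}" using P by (auto simp: parts_of_def)
    qed
    then have "\<Sum>\<^sub># P = (\<Sum>j=1..m. count P j * j)"
      using sum_mset_superset[of "{1..m}" P "\<lambda>j. j"] by simp
    then show ?thesis by simp
  qed
  have inner: "(\<Sum>P\<in>parts_of m. real (count P j) * real j * ?W P) = \<theta> j * parts_sum \<theta> (m - j)"
    if j: "j \<in> {1..m}" for j
  proof -
    have "(\<Sum>P\<in>parts_of m. real (count P j) * real j * ?W P)
        = (\<Sum>P\<in>{P\<in>parts_of m. j \<in># P}. real (count P j) * real j * ?W P)"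
      by (intro sum.mono_neutral_right finite_parts_of) (auto simp: not_in_iff)
    also have "\<dots> = (\<Sum>P\<in>{P\<in>parts_of m. j \<in># P}. \<theta> j * ?W (P - {#j#}))"
    proof (intro sum.cong refl)
      fix P assume "P \<in> {P\<in>parts_of m. j \<in># P}"
      then show "real (count P j) * real j * ?W P = \<theta> j * ?W (P - {#j#})"
        using mset_weight_remove1[of j P "\<lambda>j. \<theta> j / real j"] j by (simp add: field_simps)
    qed
    also have "\<dots> = (\<Sum>P\<in>parts_of (m - j). \<theta> j * ?W P)"
    proof (rule sum.reindex_bij_witness[of _ "\<lambda>P. add_mset j P" "\<lambda>P. P - {#j#}"])
      fix P assume "P \<in> {P\<in>parts_of m. j \<in># P}"
      then show "P - {#j#} \<in> parts_of (m - j)"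
        by (auto simp: parts_of_def sum_mset.remove dest: in_diffD)
    qed (use j in \<open>auto simp: parts_of_def\<close>)
    finally show ?thesis by (simp add: parts_sum_def sum_distrib_left)
  qed
  have "real m * parts_sum \<theta> m = (\<Sum>P\<in>parts_of m. real (\<Sum>\<^sub># P) * ?W P)"
    by (simp add: parts_sum_def sum_distrib_left parts_of_def)
  also have "\<dots> = (\<Sum>P\<in>parts_of m. \<Sum>j=1..m. real (count P j) * real j * ?W P)"
    by (intro sum.cong refl) (simp only: sm sum_distrib_right)
  also have "\<dots> = (\<Sum>j=1..m. \<Sum>P\<in>parts_of m. real (count P j) * real j * ?W P)"
    by (rule sum.swap)
  also have "\<dots> = (\<Sum>j=1..m. \<theta> j * parts_sum \<theta> (m - j))"
    by (intro sum.cong refl inner) auto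
  finally show ?thesis .
qed

lemma h_coeff_rec:
  "real m * h_coeff \<theta> m = (\<Sum>j=1..m. \<theta> j * h_coeff \<theta> (m - j))"
proof (cases m)
  case (Suc k)
  define A where "A = Abs_fps (\<lambda>j. if j = 0 then 0 else \<theta> j / real j)"
  have A0: "fps_nth A 0 = 0" by (simp add: A_def)
  define E where "E = fps_exp 1 oo A"
  have dE: "fps_deriv E = E * fps_deriv A"
    unfolding E_def using fps_compose_deriv[OF A0, of "fps_exp 1"] by simp
  have "real m * h_coeff \<theta> m = fps_nth (fps_deriv E) k"
    by (simp add: h_coeff_def E_def A_def Suc)
  also have "\<dots> = (\<Sum>i=0..k. fps_nth E i * fps_nth (fps_deriv A) (k - i))"
    by (simp add: dE fps_mult_nth)
  also have "\<dots> = (\<Sum>i=0..k. h_coeff \<theta> i * \<theta> (m - i))"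
    by (intro sum.cong refl) (auto simp: h_coeff_def E_def A_def Suc Suc_diff_le)
  also have "\<dots> = (\<Sum>j=1..m. \<theta> j * h_coeff \<theta> (m - j))"
    by (rule sum.reindex_bij_witness[of _ "\<lambda>j. m - j" "\<lambda>j. m - j"]) (auto simp: Suc)
  finally show ?thesis .
qed simp

theorem h_coeff_eq_parts_sum: "h_coeff \<theta> m = parts_sum \<theta> m"
proof (induction m rule: less_induct)
  case (less m)
  show ?case
  proof (cases "m = 0")
    case True
    have "parts_of 0 = {{#}}" by (auto simp: parts_of_def) (metis gr0I multiset_nonemptyE)
    then show ?thesis using True by (simp add: h_coeff_def parts_sum_def)
  next
    case False
    have "real m * h_coeff \<theta> m = real m * parts_sum \<theta> m"
      unfolding h_coeff_rec parts_sum_rec by (intro sum.cong refl) (use less False in auto)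
    then show ?thesis using False by simp
  qed
qed

section \<open>Splitting a spatial partition at the origin\<close>

lemma exp_neg_of_nat: "exp_neg (of_nat j * v) = exp_neg v ^ j"
proof (cases v)
  case (real r)
  then have "of_nat j * v = ennreal (real j * r)"
    by (simp add: ennreal_mult ennreal_of_nat_eq_real_of_nat)
  then show ?thesis using real by (simp add: exp_neg_def exp_of_nat_mult[symmetric])
next
  case top
  then show ?thesis by (cases "j = 0") (auto simp: exp_neg_def ennreal_mult_eq_top_iff)
qed

text \<open>
  The pair \<open>(x, j)\<close> stands for a part of size \<open>j\<close> at the site \<open>x\<close>; \<open>u x\<close> is the Boltzmann factor
  \<open>exp (- V (x/L))\<close>.
\<close>
definition cell_weight :: "(nat \<Rightarrow> real) \<Rightarrow> ('x \<Rightarrow> real) \<Rightarrow> 'x \<times> nat \<Rightarrow> real" where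
  "cell_weight \<theta> u = (\<lambda>(x, j). \<theta> j / real j * u x ^ j)"

definition total :: "('x \<times> nat) multiset \<Rightarrow> nat" where
  "total M = (\<Sum>p\<in>#M. snd p)"

definition off_cells :: "('x::zero \<times> nat) set" where
  "off_cells = (- {0}) \<times> {1..}"

definition site_part :: "('x \<times> nat) multiset \<Rightarrow> 'x \<Rightarrow> nat multiset" where
  "site_part M x = image_mset snd (filter_mset (\<lambda>p. fst p = x) M)"

definition glue :: "('x::zero \<times> nat) multiset \<times> nat multiset \<Rightarrow> 'x \<Rightarrow> nat multiset" where
  "glue = (\<lambda>(M, P) x. if x = 0 then P else site_part M x)"

lemma count_site_part [simp]: "count (site_part M x) j = count M (x, j)"
  unfolding site_part_def by (induction M) auto

lemma set_site_part: "set_mset (site_part M x) = {j. (x, j) \<in># M}"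
  by (auto simp flip: count_greater_zero_iff)

lemma Sigma_site_part:
  "(SIGMA x:fst ` set_mset M. set_mset (site_part M x)) = set_mset M"
  by (force simp: set_site_part)

lemma prod_mset_weight_site_part:
  "(\<Prod>x\<in>fst ` set_mset M. mset_weight (\<lambda>j. w (x, j)) (site_part M x)) = mset_weight w M"
proof -
  have "(\<Prod>x\<in>fst ` set_mset M. mset_weight (\<lambda>j. w (x, j)) (site_part M x))
     = (\<Prod>(x, j)\<in>(SIGMA x:fst ` set_mset M. set_mset (site_part M x)).
          w (x, j) ^ count M (x, j) / fact (count M (x, j)))"
    unfolding mset_weight_def by (subst prod.Sigma) auto
  also have "\<dots> = mset_weight w M"
    unfolding Sigma_site_part mset_weight_def by (intro prod.cong) auto
  finally show ?thesis .
qed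

lemma sum_site_part: "(\<Sum>x\<in>fst ` set_mset M. \<Sum>\<^sub># (site_part M x)) = total M"
proof -
  have "(\<Sum>x\<in>fst ` set_mset M. \<Sum>\<^sub># (site_part M x))
     = (\<Sum>x\<in>fst ` set_mset M. \<Sum>j\<in>set_mset (site_part M x). count M (x, j) * j)"
  proof (intro sum.cong refl)
    fix x
    show "\<Sum>\<^sub># (site_part M x) = (\<Sum>j\<in>set_mset (site_part M x). count M (x, j) * j)"
      using sum_mset_superset[of "set_mset (site_part M x)" "site_part M x" "\<lambda>j. j"] by simp
  qed
  also have "\<dots> = (\<Sum>(x, j)\<in>(SIGMA x:fst ` set_mset M. set_mset (site_part M x)). count M (x, j) * j)"
    by (subst sum.Sigma) auto
  also have "\<dots> = total M"
    unfolding Sigma_site_part total_def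
    by (subst sum_mset_superset[of "set_mset M"]) (auto intro!: sum.cong)
  finally show ?thesis .
qed

text \<open>
  Adding empty sites to the range of the product does not change it, which allows one range to serve a
  whole family of spatial partitions.
\<close>
lemma weight_superset:
  fixes lam :: "('d::finite) spatial_partition"
  assumes "finite A" "{x. lam x \<noteq> {#}} \<subseteq> A"
  shows "weight \<theta> V L lam =
    (\<Prod>x\<in>A. mset_weight (\<lambda>j. cell_weight \<theta> (\<lambda>x. exp_neg (V (lattice_point x /\<^sub>R L))) (x, j)) (lam x))"
proof -
  have "weight \<theta> V L lam = (\<Prod>x\<in>{x. lam x \<noteq> {#}}.
      mset_weight (\<lambda>j. cell_weight \<theta> (\<lambda>x. exp_neg (V (lattice_point x /\<^sub>R L))) (x, j)) (lam x))"
    unfolding weight_def mset_weight_def mult_part_def cell_weight_def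
    by (intro prod.cong refl) (auto simp: exp_neg_of_nat)
  also have "\<dots> = (\<Prod>x\<in>A. mset_weight (\<lambda>j. cell_weight \<theta> (\<lambda>x. exp_neg (V (lattice_point x /\<^sub>R L))) (x, j)) (lam x))"
    by (rule prod.mono_neutral_left) (use assms in auto)
  finally show ?thesis .
qed

context
  fixes M :: "((int ^ 'd::finite) \<times> nat) multiset" and P :: "nat multiset"
  assumes M: "set_mset M \<subseteq> off_cells" and P: "0 \<notin># P"
begin

lemma glue_support: "{x. glue (M, P) x \<noteq> {#}} \<subseteq> insert 0 (fst ` set_mset M)"
proof
  fix x assume "x \<in> {x. glue (M, P) x \<noteq> {#}}"
  then have "x = 0 \<or> set_mset (site_part M x) \<noteq> {}" by (auto simp: glue_def split: if_splits)
  then show "x \<in> insert 0 (fst ` set_mset M)" by (force simp: set_site_part)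
qed

lemma zero_notin_sites: "0 \<notin> fst ` set_mset M"
  using M by (auto simp: off_cells_def)

lemma glue_spatial: "glue (M, P) \<in> spatial_partitions (total M + \<Sum>\<^sub># P)"
proof -
  have "0 \<notin># glue (M, P) x" for x
    using M P by (auto simp: glue_def set_site_part off_cells_def)
  moreover have fin: "finite {x. glue (M, P) x \<noteq> {#}}"
    by (rule finite_subset[OF glue_support]) simp
  moreover have "(\<Sum>x\<in>{x. glue (M, P) x \<noteq> {#}}. \<Sum>\<^sub># (glue (M, P) x)) = total M + \<Sum>\<^sub># P"
  proof -
    have "(\<Sum>x\<in>{x. glue (M, P) x \<noteq> {#}}. \<Sum>\<^sub># (glue (M, P) x))
        = (\<Sum>x\<in>insert 0 (fst ` set_mset M). \<Sum>\<^sub># (glue (M, P) x))"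
      by (rule sum.mono_neutral_left) (use glue_support in auto)
    also have "\<dots> = \<Sum>\<^sub># P + (\<Sum>x\<in>fst ` set_mset M. \<Sum>\<^sub># (glue (M, P) x))"
      using zero_notin_sites by (simp add: glue_def)
    also have "(\<Sum>x\<in>fst ` set_mset M. \<Sum>\<^sub># (glue (M, P) x))
        = (\<Sum>x\<in>fst ` set_mset M. \<Sum>\<^sub># (site_part M x))"
      using zero_notin_sites by (intro sum.cong) (auto simp: glue_def)
    finally show ?thesis by (simp add: sum_site_part add.commute)
  qed
  ultimately show ?thesis by (simp add: spatial_partitions_def)
qed

lemma occupation_glue: "occupation (glue (M, P)) 0 = \<Sum>\<^sub># P"
  using sum_mset_superset[of "set_mset P" P "\<lambda>j. j"]
  by (simp add: occupation_def glue_def mult_part_def mult.commute)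

text \<open>
  Since \<open>V 0 = 0\<close>, the weight of the origin depends neither on \<open>V\<close> nor on \<open>L\<close>.
\<close>
lemma weight_glue:
  assumes V0: "V 0 = 0"
  shows "weight \<theta> V L (glue (M, P)) =
    mset_weight (cell_weight \<theta> (\<lambda>x. exp_neg (V (lattice_point x /\<^sub>R L)))) M *
    mset_weight (\<lambda>j. \<theta> j / real j) P"
proof -
  let ?w = "cell_weight \<theta> (\<lambda>x. exp_neg (V (lattice_point x /\<^sub>R L)))"
  have "lattice_point 0 = (0 :: real ^ 'd)" by (simp add: lattice_point_def vec_eq_iff)
  then have w0: "(\<lambda>j. ?w (0, j)) = (\<lambda>j. \<theta> j / real j)"
    by (simp add: cell_weight_def V0 exp_neg_def)
  have "weight \<theta> V L (glue (M, P)) =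
      (\<Prod>x\<in>insert 0 (fst ` set_mset M). mset_weight (\<lambda>j. ?w (x, j)) (glue (M, P) x))"
    by (rule weight_superset) (use glue_support in auto)
  also have "\<dots> = mset_weight (\<lambda>j. \<theta> j / real j) P *
      (\<Prod>x\<in>fst ` set_mset M. mset_weight (\<lambda>j. ?w (x, j)) (glue (M, P) x))"
    using zero_notin_sites by (simp add: glue_def w0)
  also have "(\<Prod>x\<in>fst ` set_mset M. mset_weight (\<lambda>j. ?w (x, j)) (glue (M, P) x))
      = (\<Prod>x\<in>fst ` set_mset M. mset_weight (\<lambda>j. ?w (x, j)) (site_part M x))"
    using zero_notin_sites by (intro prod.cong) (auto simp: glue_def)
  finally show ?thesis by (simp add: prod_mset_weight_site_part)
qed

end

lemma glue_inj: "inj_on (glue :: ((int ^ 'd::finite) \<times> nat) multiset \<times> _ \<Rightarrow> _) {(M, P). set_mset M \<subseteq> off_cells}"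
proof (rule inj_onI, clarsimp)
  fix M M' :: "((int ^ 'd) \<times> nat) multiset" and P P'
  assume M: "set_mset M \<subseteq> off_cells" "set_mset M' \<subseteq> off_cells" and e: "glue (M, P) = glue (M', P')"
  have "P = P'" using fun_cong[OF e, of 0] by (simp add: glue_def)
  moreover have "count M (x, j) = count M' (x, j)" for x j
  proof (cases "x = 0")
    case True
    then have "(x, j) \<notin># M" "(x, j) \<notin># M'" using M by (auto simp: off_cells_def)
    then show ?thesis by (simp add: not_in_iff)
  next
    case False
    then have "site_part M x = site_part M' x" using fun_cong[OF e, of x] by (simp add: glue_def)
    then show ?thesis by (metis count_site_part)
  qed
  ultimately show "M = M' \<and> P = P'" by (auto simp: multiset_eq_iff)
qed

lemma glue_surj:
  fixes lam :: "('d::finite) spatial_partition"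
  assumes lam: "lam \<in> spatial_partitions n"
  obtains M P where "set_mset M \<subseteq> off_cells" "0 \<notin># P" "lam = glue (M, P)"
proof
  define S where "S = {x. lam x \<noteq> {#}} - {0}"
  define M where "M = (\<Sum>x\<in>S. image_mset (Pair x) (lam x))"
  have fin: "finite S" and z: "0 \<notin># lam x" for x
    using lam by (auto simp: S_def spatial_partitions_def)
  have cnt1: "count (image_mset (Pair y) N) (x, j) = (if x = y then count N j else 0)" 
    for x y :: "int ^ 'd" and j and N :: "nat multiset"
    by (induction N) auto
  have cnt: "count M (x, j) = (if x = 0 then 0 else count (lam x) j)" for x j
    using fin by (auto simp: M_def count_sum cnt1 S_def)
  show "set_mset M \<subseteq> off_cells"
  proof clarify
    fix x j assume "(x, j) \<in># M"
    then have "count M (x, j) \<noteq> 0" by simp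
    then have "x \<noteq> 0" "j \<in># lam x" by (auto simp: cnt split: if_splits)
    moreover from this have "j \<noteq> 0" using z[of x] by metis
    ultimately show "(x, j) \<in> off_cells" by (simp add: off_cells_def)
  qed
  show "0 \<notin># lam 0" by (rule z)
  show "lam = glue (M, lam 0)"
    by (intro ext multiset_eqI) (auto simp: glue_def cnt)
qed

lemma bij_betw_glue:
  "bij_betw glue
     (SIGMA M:{M. set_mset M \<subseteq> off_cells \<and> total M \<le> n \<and> Q (n - total M)}. parts_of (n - total M))
     {lam \<in> spatial_partitions n. Q (occupation (lam :: ('d::finite) spatial_partition) 0)}"
    (is "bij_betw _ ?S ?T")
proof (rule bij_betw_imageI)
  show "inj_on glue ?S" by (rule inj_on_subset[OF glue_inj]) auto
  show "glue ` ?S = ?T"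
  proof (intro set_eqI iffI)
    fix lam :: "'d spatial_partition" assume "lam \<in> glue ` ?S"
    then obtain M P where MP: "lam = glue (M, P)" "set_mset M \<subseteq> off_cells" "total M \<le> n"
      "Q (n - total M)" "P \<in> parts_of (n - total M)" by auto
    then show "lam \<in> ?T" using glue_spatial[of M P] occupation_glue[of M P]
      by (auto simp: parts_of_def)
  next
    fix lam :: "'d spatial_partition" assume lam: "lam \<in> ?T"
    obtain M P where MP: "set_mset M \<subseteq> off_cells" "0 \<notin># P" "lam = glue (M, P)"
      using lam glue_surj by blast
    have "total M + \<Sum>\<^sub># P = n"
      using glue_spatial[of M P] MP lam by (auto simp: spatial_partitions_def)
    then show "lam \<in> glue ` ?S"
      using lam MP occupation_glue[of M P] by (intro image_eqI[of _ _ "(M, P)"]) (auto simp: parts_of_def)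
  qed
qed

text \<open>
  Summing over the partition at the origin, for a fixed configuration \<open>M\<close> elsewhere, leaves
  the number \<open>h\<close> of index \<open>n - total M\<close>: the origin holds exactly what \<open>M\<close> does not use.
\<close>
lemma has_sum_weight_occupation:
  fixes V :: "real ^ ('d::finite) \<Rightarrow> ennreal"
  assumes V0: "V 0 = 0"
    and summ: "(weight \<theta> V L :: 'd spatial_partition \<Rightarrow> real) summable_on spatial_partitions n"
  defines "w \<equiv> cell_weight \<theta> (\<lambda>x :: int ^ 'd. exp_neg (V (lattice_point x /\<^sub>R L)))"
  shows "((\<lambda>M. h_coeff \<theta> (n - total M) * mset_weight w M) has_sum
            (\<Sum>\<^sub>\<infinity>lam\<in>{lam \<in> spatial_partitions n. Q (occupation lam 0)}. weight \<theta> V L lam))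
          {M. set_mset M \<subseteq> off_cells \<and> total M \<le> n \<and> Q (n - total M)}"
proof -
  let ?T = "{lam \<in> spatial_partitions n. Q (occupation lam 0)} :: 'd spatial_partition set"
  let ?A = "{M :: ((int ^ 'd) \<times> nat) multiset. set_mset M \<subseteq> off_cells \<and> total M \<le> n \<and> Q (n - total M)}"
  have "weight \<theta> V L summable_on ?T" by (rule summable_on_subset[OF summ]) auto
  then have "(weight \<theta> V L has_sum infsum (weight \<theta> V L) ?T) ?T" by simp
  then have "((\<lambda>p. weight \<theta> V L (glue p)) has_sum infsum (weight \<theta> V L) ?T)
      (SIGMA M:?A. parts_of (n - total M))"
    using has_sum_reindex_bij_betw[OF bij_betw_glue] by blast
  then show ?thesis
  proof (rule has_sum_SigmaD)
    fix M assume M: "M \<in> ?A"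
    have "((\<lambda>P. weight \<theta> V L (glue (M, P))) has_sum
        (\<Sum>P\<in>parts_of (n - total M). weight \<theta> V L (glue (M, P)))) (parts_of (n - total M))"
      by (rule has_sum_finite[OF finite_parts_of])
    also have "(\<Sum>P\<in>parts_of (n - total M). weight \<theta> V L (glue (M, P)))
        = (\<Sum>P\<in>parts_of (n - total M). mset_weight w M * mset_weight (\<lambda>j. \<theta> j / real j) P)"
      using M unfolding w_def by (intro sum.cong refl weight_glue V0) (auto simp: parts_of_def)
    also have "\<dots> = h_coeff \<theta> (n - total M) * mset_weight w M"
      by (simp add: h_coeff_eq_parts_sum parts_sum_def sum_distrib_left mult.commute)
    finally show "((\<lambda>P. weight \<theta> V L (glue (M, P))) has_sum
        (h_coeff \<theta> (n - total M) * mset_weight w M)) (parts_of (n - total M))" .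
  qed
qed

section \<open>Lattice sums\<close>

lemma norm_lattice_point_ge_1:
  fixes x :: "int ^ 'd::finite" assumes "x \<noteq> 0" shows "norm (lattice_point x) \<ge> 1"
proof -
  obtain i where "x $ i \<noteq> 0" using assms by (auto simp: vec_eq_iff)
  then have "1 \<le> \<bar>lattice_point x $ i\<bar>" by (simp add: lattice_point_def)
  also have "\<dots> \<le> norm (lattice_point x)" by (rule component_le_norm_cart)
  finally show ?thesis .
qed

text \<open>
  The absence of the origin is what makes the bound \<open>O(R\<^sup>d)\<close> true for small \<open>R\<close> as well: below
  radius \<open>1\<close> no lattice point is left.
\<close>
lemma card_lattice_ball:
  fixes R :: real
  assumes "R \<ge> 0"
  defines "B \<equiv> {x :: int ^ 'd::finite. x \<noteq> 0 \<and> norm (lattice_point x) \<le> R}"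
  shows "finite B" "real (card B) \<le> (3 * R) ^ CARD('d)"
proof -
  let ?S = "{- \<lfloor>R\<rfloor>..\<lfloor>R\<rfloor>}"
  let ?P = "PiE (UNIV :: 'd set) (\<lambda>_. ?S)"
  have sub: "B \<subseteq> vec_lambda ` ?P"
  proof
    fix x assume x: "x \<in> B"
    have "x $ i \<in> ?S" for i
    proof -
      have "\<bar>lattice_point x $ i\<bar> \<le> R"
        using component_le_norm_cart[of "lattice_point x" i] x by (simp add: B_def)
      then have "of_int \<bar>x $ i\<bar> \<le> R" by (simp add: lattice_point_def)
      then have "\<bar>x $ i\<bar> \<le> \<lfloor>R\<rfloor>" by (simp add: le_floor_iff)
      then show ?thesis by auto
    qed
    then show "x \<in> vec_lambda ` ?P" by (intro image_eqI[of _ _ "\<lambda>i. x $ i"]) auto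
  qed
  have finP: "finite ?P" by (intro finite_PiE) auto
  then show "finite B" using sub finite_subset by blast
  show "real (card B) \<le> (3 * R) ^ CARD('d)"
  proof (cases "R < 1")
    case True
    then have "B = {}" using norm_lattice_point_ge_1 by (force simp: B_def)
    then show ?thesis using assms(1) by simp
  next
    case False
    have "card B \<le> card (vec_lambda ` ?P)" by (intro card_mono finite_imageI finP sub)
    also have "\<dots> \<le> card ?P" by (rule card_image_le[OF finP])
    also have "\<dots> = card ?S ^ CARD('d)" by (simp add: card_PiE)
    finally have "real (card B) \<le> real (card ?S) ^ CARD('d)" by (metis of_nat_le_iff of_nat_power)
    also have "real (card ?S) \<le> 3 * R" using False by (simp) linarith
    then have "real (card ?S) ^ CARD('d) \<le> (3 * R) ^ CARD('d)" by (intro power_mono) auto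
    finally show ?thesis .
  qed
qed

text \<open>
  Sort the lattice points into the layers \<open>k \<le> \<beta> \<parallel>x\<parallel>\<^sup>\<delta> < k + 1\<close>.  Layer \<open>k\<close> lies in a ball of radius
  \<open>((k + 1)/\<beta>)\<^bsup>1/\<delta>\<^esup>\<close>, has \<open>O(((k + 1)/\<beta>)\<^bsup>d/\<delta>\<^esup>)\<close> points and terms at most \<open>exp (- k)\<close>.  Uniformity
  in \<open>\<beta>\<close> matters because \<open>\<beta>\<close> will be proportional to \<open>j / L\<^sup>\<delta>\<close>, which can be small or large.
\<close>
lemma lattice_exp_sum_bound:
  fixes \<delta> :: real
  assumes \<delta>: "\<delta> > 0"
  obtains A where
    "\<And>\<beta>. \<beta> > 0 \<Longrightarrow> (\<lambda>x :: int ^ 'd::finite. exp (- \<beta> * norm (lattice_point x) powr \<delta>)) summable_on - {0}"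
    "\<And>\<beta>. \<beta> > 0 \<Longrightarrow> (\<Sum>\<^sub>\<infinity>x :: int ^ 'd\<in>- {0}. exp (- \<beta> * norm (lattice_point x) powr \<delta>))
        \<le> A * \<beta> powr (- real CARD('d) / \<delta>)"
proof -
  define p where "p = real CARD('d) / \<delta>"
  define c where "c = (\<lambda>k. exp (- real k) * (real k + 1) powr p)"
  have c: "summable c"
  proof (rule summable_comparison_test_bigo)
    show "summable (\<lambda>k. norm (1 / real k ^ 2))"
      using inverse_power_summable[of 2, where ?'a = real] by (simp add: inverse_eq_divide)
    show "c \<in> O(\<lambda>k. 1 / real k ^ 2)" unfolding c_def by real_asymp
  qed
  define A where "A = 3 ^ CARD('d) * suminf c"
  have c0: "c k \<ge> 0" for k by (simp add: c_def)
  have fin: "(\<Sum>x\<in>F. exp (- \<beta> * norm (lattice_point x) powr \<delta>)) \<le> A * \<beta> powr (- real CARD('d) / \<delta>)"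
    if \<beta>: "\<beta> > 0" and F: "finite F" "F \<subseteq> - {0 :: int ^ 'd}" for \<beta> F
  proof -
    define u where "u = (\<lambda>x :: int ^ 'd. \<beta> * norm (lattice_point x) powr \<delta>)"
    define k where "k = (\<lambda>x. nat \<lfloor>u x\<rfloor>)"
    have u0: "u x \<ge> 0" for x using \<beta> by (simp add: u_def)
    have k: "real (k x) \<le> u x" "u x \<le> real (k x) + 1" for x using u0[of x] by (auto simp: k_def) 
    have layer: "real (card {x\<in>F. k x = i}) \<le> 3 ^ CARD('d) * \<beta> powr (- p) * (real i + 1) powr p" for i
    proof -
      define R where "R = ((real i + 1) / \<beta>) powr (1 / \<delta>)"
      have "norm (lattice_point x) \<le> R" if "k x = i" for x :: "int ^ 'd"
      proof -
        have "norm (lattice_point x) powr \<delta> \<le> (real i + 1) / \<beta>"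
          using k(2)[of x] that \<beta> by (simp add: u_def field_simps)
        then have "(norm (lattice_point x) powr \<delta>) powr (1 / \<delta>) \<le> R"
          unfolding R_def using \<delta> by (intro powr_mono2) auto
        then show ?thesis using \<delta> by (simp add: powr_powr)
      qed
      then have sub: "{x\<in>F. k x = i} \<subseteq> {x. x \<noteq> 0 \<and> norm (lattice_point x) \<le> R}" using F by auto
      have R0: "R \<ge> 0" by (simp add: R_def)
      have "real (card {x\<in>F. k x = i}) \<le> (3 * R) ^ CARD('d)"
        using card_mono[OF card_lattice_ball(1)[OF R0] sub] card_lattice_ball(2)[OF R0, where ?'d = 'd]
        by linarith
      also have "R ^ CARD('d) = R powr real CARD('d)"
        using \<beta> by (simp add: powr_realpow R_def)
      then have "(3 * R) ^ CARD('d) = 3 ^ CARD('d) * R powr real CARD('d)"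
        by (simp add: power_mult_distrib)
      also have "R powr real CARD('d) = ((real i + 1) / \<beta>) powr p"
        by (simp add: R_def powr_powr p_def)
      also have "\<dots> = \<beta> powr (- p) * (real i + 1) powr p"
        using \<beta> by (simp add: powr_divide powr_minus field_simps)
      finally show ?thesis by (simp add: mult_ac)
    qed
    have "(\<Sum>x\<in>F. exp (- u x)) \<le> (\<Sum>x\<in>F. exp (- real (k x)))"
      by (intro sum_mono) (use k in auto)
    also have "\<dots> = (\<Sum>i\<in>k ` F. \<Sum>x\<in>{x\<in>F. k x = i}. exp (- real (k x)))"
      by (rule sum.image_gen[OF F(1)])
    also have "\<dots> = (\<Sum>i\<in>k ` F. real (card {x\<in>F. k x = i}) * exp (- real i))"
      by (intro sum.cong refl) simp
    also have "\<dots> \<le> (\<Sum>i\<in>k ` F. 3 ^ CARD('d) * \<beta> powr (- p) * c i)"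
    proof (rule sum_mono)
      fix i
      show "real (card {x\<in>F. k x = i}) * exp (- real i) \<le> 3 ^ CARD('d) * \<beta> powr (- p) * c i"
        using mult_right_mono[OF layer[of i], of "exp (- real i)"] by (simp add: c_def mult_ac)
    qed
    also have "\<dots> = 3 ^ CARD('d) * \<beta> powr (- p) * (\<Sum>i\<in>k ` F. c i)"
      by (simp add: sum_distrib_left)
    also have "\<dots> \<le> 3 ^ CARD('d) * \<beta> powr (- p) * suminf c"
      by (intro mult_left_mono sum_le_suminf c) (use F c0 in auto)
    also have "\<dots> = A * \<beta> powr (- real CARD('d) / \<delta>)" by (simp add: A_def p_def mult_ac)
    finally show ?thesis by (simp add: u_def)
  qed
  have summ: "(\<lambda>x :: int ^ 'd. exp (- \<beta> * norm (lattice_point x) powr \<delta>)) summable_on - {0}"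
    if \<beta>: "\<beta> > 0" for \<beta>
  proof (rule nonneg_bdd_above_summable_on)
    show "bdd_above (sum (\<lambda>x :: int ^ 'd. exp (- \<beta> * norm (lattice_point x) powr \<delta>)) `
        {F. F \<subseteq> - {0} \<and> finite F})"
      by (rule bdd_aboveI2[where M = "A * \<beta> powr (- real CARD('d) / \<delta>)"])
         (use fin[OF \<beta>] in blast)
  qed simp
  show ?thesis
  proof (rule that[OF summ])
    fix \<beta> :: real assume \<beta>: "\<beta> > 0"
    show "(\<Sum>\<^sub>\<infinity>x :: int ^ 'd\<in>- {0}. exp (- \<beta> * norm (lattice_point x) powr \<delta>))
        \<le> A * \<beta> powr (- real CARD('d) / \<delta>)"
      by (rule infsum_le_finite_sums[OF summ[OF \<beta>]]) (rule fin[OF \<beta>])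
  qed
qed

lemma exp_neg_nonneg: "exp_neg v \<ge> 0"
  by (auto simp: exp_neg_def)

lemma exp_neg_powr:
  assumes "s > 0" shows "exp_neg (ennreal s * v) = exp_neg v powr s"
proof (cases v)
  case (real r)
  then have "ennreal s * v = ennreal (s * r)" using assms by (simp add: ennreal_mult)
  then show ?thesis using real assms by (simp add: exp_neg_def exp_powr_real mult.commute)
next
  case top
  then show ?thesis using assms by (auto simp: exp_neg_def ennreal_mult_eq_top_iff)
qed

lemma exp_neg_power:
  assumes "j \<ge> 1" shows "exp_neg (ennreal (real j) * v) = exp_neg v ^ j"
  using exp_neg_of_nat[of j v] by (simp add: ennreal_of_nat_eq_real_of_nat)

lemma has_sum_off_cells:
  fixes u :: "'x::zero \<Rightarrow> real"
  assumes u: "\<And>x. u x \<ge> 0" and g: "\<And>j. j \<ge> 1 \<Longrightarrow> g j \<ge> 0"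
    and S: "\<And>j. j \<ge> 1 \<Longrightarrow> ((\<lambda>x. u x ^ j) has_sum S j) (- {0})"
    and T: "((\<lambda>j. g j * S j) has_sum T) {1..}"
  shows "((\<lambda>(x, j). g j * u x ^ j) has_sum T) off_cells"
proof -
  let ?f = "\<lambda>(j, x). g j * u x ^ j"
  have inner: "((\<lambda>x. ?f (j, x)) has_sum (g j * S j)) (- {0})" if "j \<in> {1..}" for j
    using has_sum_cmult_right[OF S[of j], of "g j"] that by simp
  have "?f summable_on {1..} \<times> (- {0})"
    by (rule summable_on_SigmaI[OF inner]) (use T g u in \<open>auto simp: summable_on_def\<close>)
  then have "(?f has_sum T) ({1..} \<times> (- {0}))"
    using inner T by (intro has_sum_SigmaI) auto
  then show ?thesis
    unfolding off_cells_def by (subst has_sum_swap) (simp add: case_prod_unfold)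
qed

section \<open>The lattice gas away from the origin\<close>

text \<open>
  With \<open>y = \<tau> j\<close> the left side is the effect of a tilt on a term of the logarithm of the generating
  function; the potential can absorb the right side.
\<close>
lemma abs_exp_diff_quotient_le:
  fixes y :: real
  shows "\<bar>(exp y - 1) / y\<bar> \<le> exp \<bar>y\<bar>"
proof (cases "y = 0")
  case False
  have "\<bar>exp y - 1\<bar> \<le> exp \<bar>y\<bar> * \<bar>y\<bar>"
  proof (cases "y > 0")
    case True
    have "exp y * (1 - y) \<le> exp y * exp (- y)"
      using exp_ge_add_one_self[of "- y"] by (intro mult_left_mono) auto
    then show ?thesis using True by (simp add: exp_minus algebra_simps)
  next
    case y: False
    have "1 * (- y) \<le> exp (- y) * (- y)" by (rule mult_right_mono) (use y in auto)
    moreover have "1 - exp y \<le> - y" using exp_ge_add_one_self[of y] by linarith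
    moreover have "exp y \<le> 1" using y by simp
    ultimately show ?thesis using y by simp
  qed
  then show ?thesis using False by (simp add: abs_divide divide_le_eq)
qed simp

lemma bij_betw_Suc_atLeast_1: "bij_betw Suc UNIV {1..}"
  by (rule bij_betwI[where g = "\<lambda>n. n - 1"]) auto

text \<open>
  The unique minimum and the behaviour of \<open>V\<close> at the origin are combined in \<open>decay\<close>: the potential is at
  least \<open>\<kappa> \<parallel>x\<parallel>\<^sup>\<delta>\<close> near the origin and at least the positive constant \<open>\<kappa>\<close> far away.
\<close>
locale spatial_gas =
  fixes V :: "real ^ 'd::finite \<Rightarrow> ennreal" and \<theta> :: "nat \<Rightarrow> real" and \<delta> \<kappa> :: real
  assumes delta_pos: "0 < \<delta>" and delta_less: "\<delta> < real CARD('d)"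
    and kappa_pos: "0 < \<kappa>"
    and decay: "\<And>x. x \<noteq> 0 \<Longrightarrow> exp_neg (V x) \<le> exp (- \<kappa> * min (norm x powr \<delta>) 1)"
    and V_bound: "\<And>s::real. s > 0 \<Longrightarrow> \<exists>K. \<forall>l>0.
          (\<lambda>x. exp_neg (ennreal s * V (lattice_point x /\<^sub>R l))) summable_on - {0} \<and>
          lattice_average V s l < K * boltzmann_integral V s"
    and V_limit: "\<And>s::real. s > 0 \<Longrightarrow>
          (lattice_average V s \<longlongrightarrow> boltzmann_integral V s) at_top"
    and theta_pos: "\<And>j. j \<ge> 1 \<Longrightarrow> \<theta> j > 0"
    and theta_lim: "(\<lambda>j. 1 / real j * ln (\<theta> j)) \<longlonglongrightarrow> 0"
    and theta_sum: "(\<lambda>j. \<theta> j * real j powr (- real CARD('d) / \<delta>)) summable_on {1..}"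
begin

definition site_factor :: "real \<Rightarrow> int ^ 'd \<Rightarrow> real" where
  "site_factor L x = exp_neg (V (lattice_point x /\<^sub>R L))"

lemma site_factor_nonneg: "site_factor L x \<ge> 0"
  by (simp add: site_factor_def exp_neg_nonneg)

lemma site_factor_le:
  assumes "L > 0" "x \<noteq> 0"
  shows "site_factor L x \<le> exp (- \<kappa> * min (norm (lattice_point x) powr \<delta> / L powr \<delta>) 1)"
proof -
  have "norm (lattice_point x) > 0" using norm_lattice_point_ge_1[OF assms(2)] by linarith
  then have "lattice_point x /\<^sub>R L \<noteq> 0" using assms by (metis norm_zero less_irrefl scaleR_eq_0_iff inverse_nonzero_iff_nonzero)
  then have "site_factor L x \<le> exp (- \<kappa> * min (norm (lattice_point x /\<^sub>R L) powr \<delta>) 1)"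
    unfolding site_factor_def by (rule decay)
  also have "norm (lattice_point x /\<^sub>R L) powr \<delta> = norm (lattice_point x) powr \<delta> / L powr \<delta>"
  proof -
    have "norm (lattice_point x /\<^sub>R L) = norm (lattice_point x) / L"
      using assms by (simp add: divide_inverse mult.commute)
    then show ?thesis using assms by (simp add: powr_divide)
  qed
  finally show ?thesis .
qed

lemma lattice_average_powr:
  assumes "s > 0"
  shows "lattice_average V s L = (\<Sum>\<^sub>\<infinity>x\<in>- {0}. site_factor L x powr s) / L ^ CARD('d)"
  using assms by (simp add: lattice_average_def exp_neg_powr site_factor_def)

lemma lattice_average_power:
  assumes "j \<ge> 1"
  shows "lattice_average V (real j) L = (\<Sum>\<^sub>\<infinity>x\<in>- {0}. site_factor L x ^ j) / L ^ CARD('d)"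
  unfolding lattice_average_def site_factor_def
  using exp_neg_power[OF assms] by simp

lemma summable_site_factor_powr:
  assumes "s > 0" "L > 0"
  shows "(\<lambda>x. site_factor L x powr s) summable_on - {0}"
  using V_bound[OF assms(1)] assms by (auto simp: site_factor_def exp_neg_powr)

lemma summable_site_factor_power:
  assumes "j \<ge> 1" "L > 0"
  shows "(\<lambda>x. site_factor L x ^ j) summable_on - {0}"
  using V_bound[of "real j"] assms exp_neg_power[OF assms(1)] by (auto simp: site_factor_def)

lemma lattice_average_nonneg: "L > 0 \<Longrightarrow> lattice_average V s L \<ge> 0"
  by (simp add: lattice_average_def infsum_nonneg exp_neg_nonneg)

lemma summable_theta_exp:
  assumes "\<epsilon> > 0" shows "(\<lambda>j. \<theta> j * exp (- \<epsilon> * real j)) summable_on {1..}"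
proof -
  have "eventually (\<lambda>j. 1 / real j * ln (\<theta> j) < \<epsilon> / 2) sequentially"
    using order_tendstoD(2)[OF theta_lim, of "\<epsilon> / 2"] assms by simp
  then have "eventually (\<lambda>j. norm (\<theta> j * exp (- \<epsilon> * real j)) \<le> exp (- \<epsilon> / 2) ^ j) sequentially"
    using eventually_ge_at_top[of 1]
  proof eventually_elim
    case (elim j)
    have "ln (\<theta> j) \<le> \<epsilon> / 2 * real j" using elim by (simp add: field_simps)
    then have "\<theta> j \<le> exp (\<epsilon> / 2 * real j)"
      using theta_pos[OF elim(2)] by (metis exp_le_cancel_iff exp_ln)
    then have "\<theta> j * exp (- \<epsilon> * real j) \<le> exp (\<epsilon> / 2 * real j) * exp (- \<epsilon> * real j)"
      by (intro mult_right_mono) auto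
    also have "\<dots> = exp (- \<epsilon> / 2) ^ j"
      by (simp add: exp_add[symmetric] exp_of_nat_mult[symmetric] algebra_simps)
    finally show ?case using theta_pos[OF elim(2)] by (simp add: abs_mult)
  qed
  then have "summable (\<lambda>j. norm (\<theta> j * exp (- \<epsilon> * real j)))"
    by (intro summable_comparison_test_ev[OF _ summable_geometric[of "exp (- \<epsilon> / 2)"]])
       (use assms in auto)
  then show ?thesis
    by (intro summable_on_subset[OF norm_summable_imp_summable_on, of _ "{1..}"]) auto
qed

text \<open>
  Within distance \<open>L\<close> of the origin the potential is at least \<open>\<kappa> \<parallel>x/L\<parallel>\<^sup>\<delta>\<close>, which leads to a lattice
  sum with \<open>\<beta> = \<kappa> j / (2 L\<^sup>\<delta>)\<close> and hence to the order \<open>L\<^sup>d j\<^bsup>-d/\<delta>\<^esup>\<close>.  Further out it is at least \<open>\<kappa>\<close>: all but the power \<open>1/2\<close>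
  of the Boltzmann factor is used for exponential decay in \<open>j\<close>, and the remaining power \<open>1/2\<close> for
  summability over the sites.  The exponent \<open>j/2\<close> instead of \<open>j\<close> leaves room for a tilt.
\<close>
lemma dominated_lattice_sums:
  obtains B where "(\<lambda>j. \<theta> j * B j) summable_on {1..}"
    "\<And>L j. L > 0 \<Longrightarrow> j \<ge> 1 \<Longrightarrow> (\<Sum>\<^sub>\<infinity>x\<in>- {0}. site_factor L x powr (real j / 2)) \<le> L ^ CARD('d) * B j"
proof -
  obtain A where A:
    "\<And>\<beta>. \<beta> > 0 \<Longrightarrow> (\<lambda>x :: int ^ 'd. exp (- \<beta> * norm (lattice_point x) powr \<delta>)) summable_on - {0}"
    "\<And>\<beta>. \<beta> > 0 \<Longrightarrow> (\<Sum>\<^sub>\<infinity>x :: int ^ 'd\<in>- {0}. exp (- \<beta> * norm (lattice_point x) powr \<delta>))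
        \<le> A * \<beta> powr (- real CARD('d) / \<delta>)"
    using lattice_exp_sum_bound[OF delta_pos] by blast
  \<comment> \<open>The exponent \<open>1/2\<close> is the part of \<open>j/2\<close> that is kept at distant sites.\<close>
  obtain K where K: "\<And>l. l > 0 \<Longrightarrow> lattice_average V (1/2) l < K * boltzmann_integral V (1/2)"
    using V_bound[of "1/2"] by auto
  define K' where "K' = K * boltzmann_integral V (1/2)"
  define D where "D = - real CARD('d) / \<delta>"
  define B where "B = (\<lambda>j. A * (\<kappa> / 2) powr D * real j powr D + K' * exp (\<kappa> / 2) * exp (- (\<kappa> / 2) * real j))"
  show ?thesis
  proof (rule that)
    have "(\<lambda>j. (A * (\<kappa> / 2) powr D) * (\<theta> j * real j powr D) +
        (K' * exp (\<kappa> / 2)) * (\<theta> j * exp (- (\<kappa> / 2) * real j))) summable_on {1..}"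
      unfolding D_def
      by (intro summable_on_add summable_on_cmult_right theta_sum summable_theta_exp) (use kappa_pos in auto)
    then show "(\<lambda>j. \<theta> j * B j) summable_on {1..}"
      by (simp add: B_def algebra_simps)
    fix L :: real and j :: nat assume L: "L > 0" and j: "j \<ge> 1"
    \<comment> \<open>Chosen so that \<open>\<beta> \<parallel>x\<parallel>\<^sup>\<delta> = (j/2) \<kappa> \<parallel>x/L\<parallel>\<^sup>\<delta>\<close>.\<close>
    define \<beta> where "\<beta> = \<kappa> * real j / 2 / L powr \<delta>"
    have \<beta>: "\<beta> > 0" using kappa_pos L j by (simp add: \<beta>_def)
    define e where "e = exp (\<kappa> / 2) * exp (- (\<kappa> / 2) * real j)"
    have pt: "site_factor L x powr (real j / 2) \<le>
        exp (- \<beta> * norm (lattice_point x) powr \<delta>) + e * site_factor L x powr (1 / 2)"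
      if x: "x \<in> - {0}" for x
    proof -
      define u where "u = site_factor L x"
      define q where "q = norm (lattice_point x) powr \<delta> / L powr \<delta>"
      have u: "u \<ge> 0" "u \<le> exp (- \<kappa> * min q 1)"
        using site_factor_nonneg site_factor_le[OF L, of x] x by (auto simp: u_def q_def)
      show ?thesis
      proof (cases "q \<le> 1")
        case True
        have "u powr (real j / 2) \<le> exp (- \<kappa> * q) powr (real j / 2)"
          using u True by (intro powr_mono2) auto
        also have "\<dots> = exp (- \<beta> * norm (lattice_point x) powr \<delta>)"
          by (simp add: exp_powr_real \<beta>_def q_def mult_ac)
        finally show ?thesis by (simp add: u_def[symmetric] e_def add_increasing2)
      next
        case False
        have "u powr ((real j - 1) / 2) \<le> exp (- \<kappa>) powr ((real j - 1) / 2)"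
          using u False j by (intro powr_mono2) auto
        also have "\<dots> = e"
          by (simp add: e_def exp_powr_real exp_add[symmetric] algebra_simps diff_divide_distrib)
        finally have "u powr ((real j - 1) / 2) * u powr (1 / 2) \<le> e * u powr (1 / 2)"
          by (rule mult_right_mono) simp
        moreover have "u powr (real j / 2) = u powr ((real j - 1) / 2) * u powr (1 / 2)"
          by (simp add: powr_add[symmetric] diff_divide_distrib)
        ultimately have "u powr (real j / 2) \<le> e * u powr (1 / 2)" by simp
        then show ?thesis by (simp add: u_def[symmetric] add_increasing)
      qed
    qed
    have "(\<Sum>\<^sub>\<infinity>x\<in>- {0}. site_factor L x powr (real j / 2)) \<le>
        (\<Sum>\<^sub>\<infinity>x\<in>- {0}. exp (- \<beta> * norm (lattice_point x) powr \<delta>) + e * site_factor L x powr (1 / 2))"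
      by (intro infsum_mono pt summable_on_add A(1) \<beta> summable_on_cmult_right summable_site_factor_powr)
         (use L j in auto)
    also have "\<dots> = (\<Sum>\<^sub>\<infinity>x :: int ^ 'd\<in>- {0}. exp (- \<beta> * norm (lattice_point x) powr \<delta>))
        + e * (\<Sum>\<^sub>\<infinity>x\<in>- {0}. site_factor L x powr (1 / 2))"
      by (subst infsum_add)
         (use A(1)[OF \<beta>] L in \<open>auto simp: infsum_cmult_right' intro!: summable_on_cmult_right summable_site_factor_powr\<close>)
    also have "\<dots> \<le> A * \<beta> powr D + e * (L ^ CARD('d) * K')"
    proof (intro add_mono mult_left_mono)
      show "(\<Sum>\<^sub>\<infinity>x\<in>- {0}. site_factor L x powr (1 / 2)) \<le> L ^ CARD('d) * K'"
        using K[OF L] L by (simp add: lattice_average_powr K'_def field_simps)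
    qed (use A(2)[OF \<beta>] in \<open>auto simp: D_def e_def\<close>)
    also have "\<beta> powr D = L ^ CARD('d) * ((\<kappa> / 2) powr D * real j powr D)"
    proof -
      have "\<beta> powr D = ((\<kappa> / 2) * real j) powr D / (L powr \<delta>) powr D"
        by (simp add: \<beta>_def flip: powr_divide)
      also have "(L powr \<delta>) powr D = inverse (L ^ CARD('d))"
        using L delta_pos by (simp add: powr_powr D_def powr_minus powr_realpow)
      also have "((\<kappa> / 2) * real j) powr D = (\<kappa> / 2) powr D * real j powr D"
        by (rule powr_mult)
      finally show ?thesis by (simp add: field_simps)
    qed
    finally show "(\<Sum>\<^sub>\<infinity>x\<in>- {0}. site_factor L x powr (real j / 2)) \<le> L ^ CARD('d) * B j"
      by (simp add: B_def e_def algebra_simps)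
  qed
qed

text \<open>
  A site other than the origin is at distance at least \<open>1/L\<close> after rescaling, so its potential is at
  least \<open>\<kappa> L\<^bsup>-\<delta>\<^esup> \<ge> 2 \<bar>\<tau>\<bar>\<close>; half of it pays for the tilt.
\<close>
lemma tilted_site_factor_le:
  assumes L: "L \<ge> 1" and x: "x \<noteq> 0" and \<tau>: "\<bar>\<tau>\<bar> \<le> \<kappa> / 2 * L powr (- \<delta>)" and j: "j \<ge> 1"
  shows "exp (\<bar>\<tau>\<bar> * real j) * site_factor L x ^ j \<le> site_factor L x powr (real j / 2)"
proof -
  define u where "u = site_factor L x"
  have "L powr (- \<delta>) \<le> 1" using L delta_pos by (simp add: powr_minus inverse_le_1_iff ge_one_powr_ge_zero)
  moreover have "1 * inverse (L powr \<delta>) \<le> norm (lattice_point x) powr \<delta> * inverse (L powr \<delta>)"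
    by (intro mult_right_mono ge_one_powr_ge_zero norm_lattice_point_ge_1 x less_imp_le[OF delta_pos]) auto
  then have "L powr (- \<delta>) \<le> norm (lattice_point x) powr \<delta> / L powr \<delta>"
    by (simp add: powr_minus divide_inverse)
  ultimately have "L powr (- \<delta>) \<le> min (norm (lattice_point x) powr \<delta> / L powr \<delta>) 1" by simp
  then have "\<kappa> * L powr (- \<delta>) \<le> \<kappa> * min (norm (lattice_point x) powr \<delta> / L powr \<delta>) 1"
    using kappa_pos by (intro mult_left_mono) auto
  then have "u \<le> exp (- (2 * \<bar>\<tau>\<bar>))"
    using order.trans[OF site_factor_le[of L x], of "exp (- (2 * \<bar>\<tau>\<bar>))"] L x \<tau> unfolding u_def by simp
  then have "u powr (real j / 2) \<le> exp (- (2 * \<bar>\<tau>\<bar>)) powr (real j / 2)"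
    using site_factor_nonneg by (intro powr_mono2) (auto simp: u_def)
  also have "\<dots> = exp (- (\<bar>\<tau>\<bar> * real j))" by (simp add: exp_powr_real)
  finally have "exp (\<bar>\<tau>\<bar> * real j) * u powr (real j / 2) \<le> 1"
    by (simp add: exp_minus field_simps)
  then have "exp (\<bar>\<tau>\<bar> * real j) * u powr (real j / 2) * u powr (real j / 2) \<le> 1 * u powr (real j / 2)"
    by (intro mult_right_mono) auto
  moreover have "u ^ j = u powr (real j / 2) * u powr (real j / 2)"
  proof (cases "u = 0")
    case False
    then show ?thesis using site_factor_nonneg[of L x]
      by (simp add: powr_add[symmetric] powr_realpow u_def less_le)
  qed (use j in auto)
  ultimately show ?thesis by (simp add: u_def)
qed

definition gas_weight :: "real \<Rightarrow> (int ^ 'd) \<times> nat \<Rightarrow> real" where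
  "gas_weight L = cell_weight \<theta> (site_factor L)"

text \<open>
  By the exponential formula this is the logarithm of the moment generating function of \<open>total\<close> at
  \<open>\<tau>\<close>, without normalisation.
\<close>
definition log_partition :: "real \<Rightarrow> real \<Rightarrow> real" where
  "log_partition L \<tau> = (\<Sum>\<^sub>\<infinity>p\<in>off_cells. gas_weight L p * exp (\<tau> * real (snd p)))"

lemma gas_weight_nonneg: "p \<in> off_cells \<Longrightarrow> gas_weight L p \<ge> 0"
  using theta_pos by (auto simp: gas_weight_def cell_weight_def off_cells_def site_factor_nonneg less_imp_le)

text \<open>
  The series over cells, arranged by part size.  The last bound is the domination for
  Tannery's theorem.
\<close>
lemma has_sum_gas_weight:
  assumes L: "L \<ge> 1" and \<tau>: "\<bar>\<tau>\<bar> \<le> \<kappa> / 2 * L powr (- \<delta>)"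
  shows "(\<lambda>p. gas_weight L p * exp (\<tau> * real (snd p))) summable_on off_cells"
    "((\<lambda>j. \<theta> j / real j * exp (\<tau> * real j) * (L ^ CARD('d) * lattice_average V (real j) L))
        has_sum log_partition L \<tau>) {1..}"
    "\<And>j. j \<ge> 1 \<Longrightarrow> exp (\<bar>\<tau>\<bar> * real j) * (L ^ CARD('d) * lattice_average V (real j) L)
        \<le> (\<Sum>\<^sub>\<infinity>x\<in>- {0}. site_factor L x powr (real j / 2))"
proof -
  have L0: "L > 0" using L by simp
  show le: "exp (\<bar>\<tau>\<bar> * real j) * (L ^ CARD('d) * lattice_average V (real j) L)
      \<le> (\<Sum>\<^sub>\<infinity>x\<in>- {0}. site_factor L x powr (real j / 2))" if j: "j \<ge> 1" for j
  proof -
    have "exp (\<bar>\<tau>\<bar> * real j) * (L ^ CARD('d) * lattice_average V (real j) L)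
        = (\<Sum>\<^sub>\<infinity>x\<in>- {0}. exp (\<bar>\<tau>\<bar> * real j) * site_factor L x ^ j)"
      using L0 by (simp add: lattice_average_power[OF j] infsum_cmult_right')
    also have "\<dots> \<le> (\<Sum>\<^sub>\<infinity>x\<in>- {0}. site_factor L x powr (real j / 2))"
      by (intro infsum_mono summable_on_cmult_right summable_site_factor_power summable_site_factor_powr
          tilted_site_factor_le) (use L L0 \<tau> j in auto)
    finally show ?thesis .
  qed
  obtain B where B: "(\<lambda>j. \<theta> j * B j) summable_on {1..}"
    "\<And>L j. L > 0 \<Longrightarrow> j \<ge> 1 \<Longrightarrow> (\<Sum>\<^sub>\<infinity>x\<in>- {0}. site_factor L x powr (real j / 2)) \<le> L ^ CARD('d) * B j"
    by (rule dominated_lattice_sums) (rule that)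
  let ?S = "\<lambda>j. L ^ CARD('d) * lattice_average V (real j) L"
  have S0: "?S j \<ge> 0" for j using L0 lattice_average_nonneg by simp
  define g where "g = (\<lambda>j. \<theta> j / real j * exp (\<tau> * real j))"
  have g0: "g j \<ge> 0" if "j \<ge> 1" for j using theta_pos[OF that] by (simp add: g_def)
  have "(\<lambda>j. g j * ?S j) summable_on {1..}"
  proof (rule summable_on_comparison_test)
    show "(\<lambda>j. L ^ CARD('d) * (\<theta> j * B j)) summable_on {1..}"
      by (intro summable_on_cmult_right B)
    fix j :: nat assume "j \<in> {1..}"
    then have j: "j \<ge> 1" by simp
    show "0 \<le> g j * ?S j" using g0[OF j] S0 by simp
    have "exp (\<tau> * real j) * ?S j \<le> exp (\<bar>\<tau>\<bar> * real j) * ?S j"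
      by (intro mult_right_mono S0) (simp add: mult_right_mono)
    also have "\<dots> \<le> L ^ CARD('d) * B j" using le[OF j] B(2)[OF L0 j] by simp
    finally have 1: "exp (\<tau> * real j) * ?S j \<le> L ^ CARD('d) * B j" .
    have "\<theta> j / real j \<le> \<theta> j" using theta_pos[OF j] j by (simp add: divide_le_eq)
    then have "\<theta> j / real j * (exp (\<tau> * real j) * ?S j) \<le> \<theta> j * (L ^ CARD('d) * B j)"
      by (intro mult_mono 1) (use theta_pos[OF j] S0 in auto)
    then show "g j * ?S j \<le> L ^ CARD('d) * (\<theta> j * B j)" by (simp add: g_def mult_ac)
  qed
  then have hs: "((\<lambda>j. g j * ?S j) has_sum (infsum (\<lambda>j. g j * ?S j) {1..})) {1..}" by simp
  have S: "((\<lambda>x. site_factor L x ^ j) has_sum ?S j) (- {0})" if "j \<ge> 1" for j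
    using has_sum_infsum[OF summable_site_factor_power[OF that L0]] L0
    by (simp add: lattice_average_power[OF that])
  have "((\<lambda>(x, j). g j * site_factor L x ^ j) has_sum (infsum (\<lambda>j. g j * ?S j) {1..})) off_cells"
    by (rule has_sum_off_cells[OF site_factor_nonneg g0 S hs])
  then have hs2: "((\<lambda>p. gas_weight L p * exp (\<tau> * real (snd p))) has_sum (infsum (\<lambda>j. g j * ?S j) {1..})) off_cells"
    by (simp add: gas_weight_def cell_weight_def g_def case_prod_unfold mult_ac)
  then show "(\<lambda>p. gas_weight L p * exp (\<tau> * real (snd p))) summable_on off_cells"
    by (auto simp: summable_on_def)
  have "log_partition L \<tau> = infsum (\<lambda>j. g j * ?S j) {1..}"
    unfolding log_partition_def using hs2 by (rule infsumI)
  then show "((\<lambda>j. \<theta> j / real j * exp (\<tau> * real j) * ?S j) has_sum log_partition L \<tau>) {1..}"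
    using hs by (simp add: g_def)
qed

text \<open>
  The quotient is \<open>\<Sum>j. \<theta>\<^sub>j * (exp (\<tau> j) - 1)/(\<tau> j) * lattice_average V j L\<close>.  Each term tends to
  \<open>\<theta>\<^sub>j * boltzmann_integral V j\<close> because \<open>\<tau> \<rightarrow> 0\<close>, and the terms are dominated, so the sum tends to
  the critical density.
\<close>
lemma log_partition_difference:
  assumes \<gamma>: "\<delta> < \<gamma>" and \<sigma>: "\<sigma> = 1 \<or> \<sigma> = - 1"
  defines "\<tau> \<equiv> \<lambda>L. \<sigma> * L powr (- \<gamma>)"
  shows "((\<lambda>L. (log_partition L (\<tau> L) - log_partition L 0) / (\<tau> L * L ^ CARD('d)))
      \<longlongrightarrow> critical_density \<theta> V) at_top"
    and "\<forall>\<^sub>F L in at_top. \<bar>\<tau> L\<bar> \<le> \<kappa> / 2 * L powr (- \<delta>)"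
proof -
  have abs\<tau>: "\<bar>\<tau> L\<bar> = L powr (- \<gamma>)" for L using \<sigma> by (auto simp: \<tau>_def abs_mult)
  have \<gamma>0: "\<gamma> > 0" using \<gamma> delta_pos by simp
  have "((\<lambda>L. L powr (\<delta> - \<gamma>)) \<longlongrightarrow> 0) at_top"
    using \<gamma> by (intro tendsto_neg_powr filterlim_ident) auto
  then have "\<forall>\<^sub>F L in at_top. L powr (\<delta> - \<gamma>) < \<kappa> / 2"
    using order_tendstoD(2)[of _ 0 at_top "\<kappa> / 2"] kappa_pos by simp
  then show small: "\<forall>\<^sub>F L in at_top. \<bar>\<tau> L\<bar> \<le> \<kappa> / 2 * L powr (- \<delta>)"
    using eventually_gt_at_top[of 0]
  proof eventually_elim
    case (elim L)
    have "L powr (- \<gamma>) = L powr (\<delta> - \<gamma>) * L powr (- \<delta>)" by (simp add: powr_add[symmetric])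
    also have "\<dots> \<le> \<kappa> / 2 * L powr (- \<delta>)" using elim by (intro mult_right_mono) auto
    finally show ?case by (simp add: abs\<tau>)
  qed
  have \<tau>0: "(\<tau> \<longlongrightarrow> 0) at_top"
    unfolding \<tau>_def using \<gamma>0 by (intro tendsto_mult_right_zero tendsto_neg_powr filterlim_ident) auto
  obtain B where B: "(\<lambda>j. \<theta> j * B j) summable_on {1..}"
    "\<And>L j. L > 0 \<Longrightarrow> j \<ge> 1 \<Longrightarrow> (\<Sum>\<^sub>\<infinity>x\<in>- {0}. site_factor L x powr (real j / 2)) \<le> L ^ CARD('d) * B j"
    by (rule dominated_lattice_sums) (rule that)
  \<comment> \<open>Part sizes start at \<open>1\<close>, hence the shift by \<open>Suc\<close>.\<close>
  define a where "a = (\<lambda>k L. \<theta> (Suc k) * ((exp (\<tau> L * real (Suc k)) - 1) / (\<tau> L * real (Suc k))) *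
      lattice_average V (real (Suc k)) L)"
  define b where "b = (\<lambda>k. \<theta> (Suc k) * boltzmann_integral V (real (Suc k)))"
  have lim: "((\<lambda>L. a k L) \<longlongrightarrow> b k) at_top" for k
  proof -
    have "((\<lambda>L. \<tau> L * real (Suc k)) \<longlongrightarrow> 0) at_top"
      by (intro tendsto_mult_left_zero \<tau>0)
    moreover have "\<forall>\<^sub>F L in at_top. \<tau> L * real (Suc k) \<noteq> 0"
      using eventually_gt_at_top[of 0] by eventually_elim (use \<sigma> in \<open>auto simp: \<tau>_def\<close>)
    ultimately have "filterlim (\<lambda>L. \<tau> L * real (Suc k)) (at 0) at_top"
      by (simp add: filterlim_at)
    then have "((\<lambda>L. (exp (\<tau> L * real (Suc k)) - 1) / (\<tau> L * real (Suc k))) \<longlongrightarrow> 1) at_top"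
      by (rule filterlim_compose[OF lim_exp_minus_1])
    then have "((\<lambda>L. a k L) \<longlongrightarrow> \<theta> (Suc k) * 1 * boltzmann_integral V (real (Suc k))) at_top"
      unfolding a_def by (intro tendsto_mult tendsto_const V_limit) auto
    then show ?thesis by (simp add: b_def)
  qed
  have bound: "\<forall>\<^sub>F L in at_top. \<forall>k. norm (a k L) \<le> \<theta> (Suc k) * B (Suc k)"
    using small eventually_ge_at_top[of 1]
  proof eventually_elim
    case (elim L)
    show ?case
    proof
      fix k
      let ?j = "Suc k" and ?N = "L ^ CARD('d)"
      have av0: "lattice_average V (real ?j) L \<ge> 0" using elim by (intro lattice_average_nonneg) auto
      have N0: "?N > 0" using elim by simp
      have "exp (\<bar>\<tau> L\<bar> * real ?j) * (?N * lattice_average V (real ?j) L) \<le> ?N * B ?j"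
        by (rule order.trans[OF has_sum_gas_weight(3)[OF elim(2,1)] B(2)]) (use elim in auto)
      then have "?N * (exp (\<bar>\<tau> L\<bar> * real ?j) * lattice_average V (real ?j) L) \<le> ?N * B ?j"
        by (metis mult.left_commute)
      then have 1: "exp (\<bar>\<tau> L\<bar> * real ?j) * lattice_average V (real ?j) L \<le> B ?j"
        using N0 by (simp only: mult_le_cancel_left_pos)
      have "norm (a k L) = \<theta> ?j * (\<bar>(exp (\<tau> L * real ?j) - 1) / (\<tau> L * real ?j)\<bar> * lattice_average V (real ?j) L)"
        using theta_pos[of ?j] av0 by (simp add: a_def abs_mult)
      also have "\<dots> \<le> \<theta> ?j * (exp \<bar>\<tau> L * real ?j\<bar> * lattice_average V (real ?j) L)"
        using theta_pos[of ?j] av0 by (intro mult_left_mono mult_right_mono abs_exp_diff_quotient_le) auto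
      also have "\<dots> \<le> \<theta> ?j * B ?j"
        using theta_pos[of ?j] 1 by (intro mult_left_mono) (auto simp: abs_mult)
      finally show "norm (a k L) \<le> \<theta> ?j * B ?j" .
    qed
  qed
  have sB: "summable (\<lambda>k. \<theta> (Suc k) * B (Suc k))"
    using summable_on_reindex_bij_betw[OF bij_betw_Suc_atLeast_1, of "\<lambda>j. \<theta> j * B j"] B(1)
    by (intro summable_on_imp_summable) simp
  have bound2: "\<forall>\<^sub>F (k, L) in at_top \<times>\<^sub>F at_top. norm (a k L) \<le> \<theta> (Suc k) * B (Suc k)"
    using eventually_prodI[OF always_eventually[of "\<lambda>_. True"] bound, where F = at_top]
    by (auto elim!: eventually_mono)
  have tan: "\<forall>\<^sub>F L in at_top. summable (\<lambda>k. norm (a k L))" "summable (\<lambda>k. norm (b k))"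
    "((\<lambda>L. suminf (\<lambda>k. a k L)) \<longlongrightarrow> suminf b) at_top"
    using tannerys_theorem[OF lim bound2 sB] by auto
  have "(b has_sum suminf b) UNIV"
    by (rule norm_summable_imp_has_sum[OF tan(2)]) (use tan(2) summable_norm_cancel summable_sums in blast)
  then have "((\<lambda>j. \<theta> j * boltzmann_integral V (real j)) has_sum suminf b) {1..}"
    using has_sum_reindex_bij_betw[OF bij_betw_Suc_atLeast_1, of "\<lambda>j. \<theta> j * boltzmann_integral V (real j)"]
    by (simp add: b_def)
  then have rc: "suminf b = critical_density \<theta> V"
    unfolding critical_density_def by (simp add: infsumI)
  have "\<forall>\<^sub>F L in at_top. suminf (\<lambda>k. a k L) =
      (log_partition L (\<tau> L) - log_partition L 0) / (\<tau> L * L ^ CARD('d))"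
    using small eventually_ge_at_top[of 1] tan(1)
  proof eventually_elim
    case (elim L)
    let ?N = "L ^ CARD('d)"
    have N0: "?N > 0" using elim by simp
    have \<tau>n0: "\<tau> L \<noteq> 0" using elim \<sigma> by (auto simp: \<tau>_def)
    have "((\<lambda>j. - (\<theta> j / real j * exp (0 * real j) * (?N * lattice_average V (real j) L)))
        has_sum - log_partition L 0) {1..}"
      by (intro has_sum_uminusI has_sum_gas_weight(2)) (use elim kappa_pos in auto)
    with has_sum_gas_weight(2)[OF elim(2,1)]
    have "((\<lambda>j. \<theta> j / real j * exp (\<tau> L * real j) * (?N * lattice_average V (real j) L)
         - \<theta> j / real j * exp (0 * real j) * (?N * lattice_average V (real j) L))
        has_sum (log_partition L (\<tau> L) - log_partition L 0)) {1..}"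
      unfolding diff_conv_add_uminus by (rule has_sum_add)
    then have "((\<lambda>j. 1 / (\<tau> L * ?N) * (\<theta> j / real j * exp (\<tau> L * real j) * (?N * lattice_average V (real j) L)
         - \<theta> j / real j * exp (0 * real j) * (?N * lattice_average V (real j) L)))
        has_sum (1 / (\<tau> L * ?N) * (log_partition L (\<tau> L) - log_partition L 0))) {1..}"
      by (rule has_sum_cmult_right)
    then have "((\<lambda>k. a k L) has_sum (1 / (\<tau> L * ?N) * (log_partition L (\<tau> L) - log_partition L 0))) UNIV"
      unfolding has_sum_reindex_bij_betw[OF bij_betw_Suc_atLeast_1, symmetric]
      by (rule has_sum_cong[THEN iffD1, rotated]) (use elim(2) \<tau>n0 in \<open>auto simp: a_def divide_simps right_diff_distrib left_diff_distrib\<close>)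
    then show ?case using has_sum_imp_sums sums_unique by fastforce
  qed
  then show "((\<lambda>L. (log_partition L (\<tau> L) - log_partition L 0) / (\<tau> L * L ^ CARD('d)))
      \<longlongrightarrow> critical_density \<theta> V) at_top"
    using tan(3) unfolding rc by (rule Lim_transform_eventually[rotated])
qed

text \<open>
  Chernoff's bound with the tilt \<open>\<sigma> L\<^bsup>-\<gamma>\<^esup>\<close>.  The sign \<open>\<sigma> = 1\<close> treats \<open>y > \<rho>\<^sub>c\<close> and excess, \<open>\<sigma> = - 1\<close>
  treats \<open>y < \<rho>\<^sub>c\<close> and deficit.  The exponent is \<open>\<tau> N (\<rho>\<^sub>c + o(1) - y)\<close> and
  \<open>\<bar>\<tau>\<bar> N = L\<^bsup>d - \<gamma>\<^esup>\<close>.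
\<close>
lemma total_tail_bound:
  assumes \<gamma>: "\<delta> < \<gamma>" and \<sigma>: "\<sigma> = 1 \<or> \<sigma> = - 1"
    and y: "0 < \<sigma> * (y - critical_density \<theta> V)"
  obtains \<eta> where "\<eta> > 0"
    "\<forall>\<^sub>F L in at_top. infsum (mset_weight (gas_weight L))
        {M. set_mset M \<subseteq> off_cells \<and> \<sigma> * (y * L ^ CARD('d)) \<le> \<sigma> * real (total M)}
      \<le> exp (- \<eta> * L powr (real CARD('d) - \<gamma>)) * exp (log_partition L 0)"
proof -
  define \<eta> where "\<eta> = \<sigma> * (y - critical_density \<theta> V) / 2"
  define \<tau> where "\<tau> = (\<lambda>L. \<sigma> * L powr (- \<gamma>))"
  define D where "D = (\<lambda>L. (log_partition L (\<tau> L) - log_partition L 0) / (\<tau> L * L ^ CARD('d)))"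
  have lim: "(D \<longlongrightarrow> critical_density \<theta> V) at_top"
    and small: "\<forall>\<^sub>F L in at_top. \<bar>\<tau> L\<bar> \<le> \<kappa> / 2 * L powr (- \<delta>)"
    unfolding D_def \<tau>_def using log_partition_difference[OF \<gamma> \<sigma>] by auto
  have "((\<lambda>L. \<sigma> * (y - D L)) \<longlongrightarrow> \<sigma> * (y - critical_density \<theta> V)) at_top"
    by (intro tendsto_intros lim)
  then have "\<forall>\<^sub>F L in at_top. \<sigma> * (y - D L) > \<eta>"
    by (rule order_tendstoD(1)) (use y in \<open>auto simp: \<eta>_def\<close>)
  then have "\<forall>\<^sub>F L in at_top. infsum (mset_weight (gas_weight L))
        {M. set_mset M \<subseteq> off_cells \<and> \<sigma> * (y * L ^ CARD('d)) \<le> \<sigma> * real (total M)}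
      \<le> exp (- \<eta> * L powr (real CARD('d) - \<gamma>)) * exp (log_partition L 0)"
    using small eventually_ge_at_top[of 1]
  proof eventually_elim
    case (elim L)
    let ?N = "L ^ CARD('d)" and ?S = "{M. set_mset M \<subseteq> off_cells \<and> \<sigma> * (y * L ^ CARD('d)) \<le> \<sigma> * real (total M)}"
    have N0: "?N > 0" using elim by simp
    have \<tau>n0: "\<tau> L \<noteq> 0" using elim \<sigma> by (auto simp: \<tau>_def)
    have "infsum (mset_weight (gas_weight L)) ?S \<le> exp (- \<tau> L * (y * ?N)) *
        exp (\<Sum>\<^sub>\<infinity>p\<in>off_cells. gas_weight L p * exp (\<tau> L * real (snd p)))"
    proof (rule mset_weight_tail_bound)
      show "gas_weight L summable_on off_cells"
        using has_sum_gas_weight(1)[OF elim(3), of 0] kappa_pos by simp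
      fix M assume M: "M \<in> ?S"
      have "(\<Sum>p\<in>#M. real (snd p)) = real (total M)" by (induction M) (auto simp: total_def)
      moreover have "L powr - \<gamma> * (\<sigma> * (y * ?N)) \<le> L powr - \<gamma> * (\<sigma> * real (total M))"
        by (rule mult_left_mono) (use M in auto)
      ultimately show "\<tau> L * (y * ?N) \<le> \<tau> L * (\<Sum>p\<in>#M. real (snd p))"
        by (simp add: \<tau>_def mult_ac)
    qed (use gas_weight_nonneg has_sum_gas_weight(1)[OF elim(3,2)] in auto)
    also have "\<dots> = exp (log_partition L (\<tau> L) - \<tau> L * (y * ?N))"
      by (simp add: log_partition_def exp_add[symmetric])
    also have "log_partition L (\<tau> L) = log_partition L 0 + \<tau> L * ?N * D L"
      using elim(3) \<tau>n0 by (simp add: D_def)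
    also have "exp (log_partition L 0 + \<tau> L * ?N * D L - \<tau> L * (y * ?N))
        \<le> exp (- \<eta> * L powr (real CARD('d) - \<gamma>) + log_partition L 0)"
    proof -
      have e: "L powr (real CARD('d) - \<gamma>) = L powr (- \<gamma>) * ?N"
      proof -
        have "L powr (real CARD('d) - \<gamma>) = L powr (- \<gamma>) * L powr real CARD('d)"
          by (simp add: powr_add[symmetric])
        then show ?thesis using elim(3) by (simp add: powr_realpow)
      qed
      have "\<eta> * L powr (real CARD('d) - \<gamma>) \<le> \<sigma> * (y - D L) * L powr (real CARD('d) - \<gamma>)"
        using elim by (intro mult_right_mono) auto
      also have "\<dots> = \<tau> L * (y * ?N) - \<tau> L * ?N * D L"
        unfolding e by (simp add: \<tau>_def algebra_simps)
      finally show ?thesis by simp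
    qed
    finally show ?case by (simp only: exp_add)
  qed
  then show ?thesis using that[of \<eta>] y by (simp add: \<eta>_def)
qed

end

section \<open>The partition measure\<close>

lemma weight_nonneg:
  fixes lam :: "('d::finite) spatial_partition"
  assumes theta: "\<And>j. j \<ge> 1 \<Longrightarrow> \<theta> j > 0" and lam: "lam \<in> spatial_partitions n"
  shows "weight \<theta> V L lam \<ge> 0"
  unfolding weight_def
proof (intro prod_nonneg ballI mult_nonneg_nonneg zero_le_power)
  fix x j assume "j \<in># lam x"
  then have "j \<noteq> 0" using lam by (metis (mono_tags, lifting) mem_Collect_eq spatial_partitions_def)
  then show "0 \<le> \<theta> j / real j" using theta[of j] by simp
qed (simp_all add: exp_neg_nonneg)

lemma measure_partition_measure:
  fixes V :: "real ^ ('d::finite) \<Rightarrow> ennreal"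
  assumes theta: "\<And>j. j \<ge> 1 \<Longrightarrow> \<theta> j > 0"
    and summ: "(weight \<theta> V L :: 'd spatial_partition \<Rightarrow> real) summable_on spatial_partitions n"
    and X: "X \<subseteq> spatial_partitions n"
  shows "measure (partition_measure \<theta> V L n) X = infsum (weight \<theta> V L) X / partition_fun \<theta> V L n"
proof -
  let ?Z = "partition_fun \<theta> V L n"
  let ?f = "\<lambda>lam :: 'd spatial_partition. weight \<theta> V L lam / ?Z"
  have w0: "weight \<theta> V L lam \<ge> 0" if "lam \<in> spatial_partitions n" for lam :: "'d spatial_partition"
    by (rule weight_nonneg[OF theta that])
  have Z0: "?Z \<ge> 0" unfolding partition_fun_def by (rule infsum_nonneg) (rule w0)
  have f0: "?f lam \<ge> 0" if "lam \<in> X" for lam using w0[of lam] X Z0 that by auto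
  have fsum: "?f summable_on X"
    using summable_on_cmult_left[OF summable_on_subset[OF summ X], of "1 / ?Z"] by simp
  have "(\<lambda>lam. norm (?f lam)) summable_on X"
    using fsum by (rule summable_on_cong[THEN iffD1, rotated]) (simp only: real_norm_def abs_of_nonneg[OF f0])
  note fabs = iffD1[OF abs_summable_equivalent this]
  have "emeasure (partition_measure \<theta> V L n) X = (\<integral>\<^sup>+lam. ennreal (?f lam) * indicator X lam \<partial>count_space (spatial_partitions n))"
    unfolding partition_measure_def point_measure_def using X by (subst emeasure_density) auto
  also have "\<dots> = (\<integral>\<^sup>+lam. ennreal (?f lam) \<partial>count_space X)"
    by (subst nn_integral_count_space_indicator, simp, subst nn_integral_count_space_indicator, simp)
       (use X in \<open>auto intro!: nn_integral_cong simp: indicator_def\<close>)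
  also have "\<dots> = ennreal (infsum ?f X)"
    using nn_integral_conv_infsetsum[OF fabs f0] infsetsum_infsum[OF fabs] by simp
  finally have "measure (partition_measure \<theta> V L n) X = infsum ?f X"
    using f0 by (simp add: measure_def infsum_nonneg)
  also have "infsum ?f X = infsum (weight \<theta> V L) X / ?Z"
    using infsum_cmult_left'[of "weight \<theta> V L" "1 / ?Z" X] by simp
  finally show ?thesis .
qed

text \<open>
  A single pair of bounds for all indices up to \<open>n\<close>.  Passing to a positive exponent \<open>s \<ge> a\<close> makes
  the bounds monotone in the index even when \<open>a\<close> is negative.  The index \<open>0\<close> is covered because
  the two bounds on \<open>h\<^sub>1\<close> are compatible only if \<open>C * exp c \<ge> 1\<close>.
\<close>
lemma h_coeff_bounds_up_to:
  assumes theta: "\<theta> 1 > 0" and c: "0 \<le> c" and C: "0 \<le> C" and a: "a \<le> s" and s: "s > 0"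
    and h_bounds: "\<And>m. m \<ge> 1 \<Longrightarrow>
          inverse C * exp (- c * real m powr a) \<le> h_coeff \<theta> m \<and>
          h_coeff \<theta> m \<le> C * exp (c * real m powr a)"
    and m: "m \<le> n" "n \<ge> 1"
  shows "0 < C" "inverse C * exp (- c * real n powr s) \<le> h_coeff \<theta> m"
    "h_coeff \<theta> m \<le> C * exp (c * real n powr s)"
proof -
  have h0: "h_coeff \<theta> 0 = 1" by (simp add: h_coeff_def)
  have h1: "h_coeff \<theta> 1 = \<theta> 1" using h_coeff_rec[of 1 \<theta>] h0 by simp
  show C0: "0 < C"
  proof (rule ccontr)
    assume "\<not> 0 < C"
    then have "C = 0" using C by simp
    then show False using h_bounds[of 1] h1 theta by simp
  qed
  \<comment> \<open>Otherwise the lower bound for \<open>h\<^sub>1\<close> would exceed the upper one.\<close>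
  have "1 \<le> C * exp c"
  proof (rule ccontr)
    assume *: "\<not> 1 \<le> C * exp c"
    have "inverse C * exp (- c) = inverse (C * exp c)" by (simp add: exp_minus)
    also have "\<dots> > 1" using * C0 by (intro one_less_inverse) auto
    finally show False using h_bounds[of 1] * by simp
  qed
  have mono: "real m powr a \<le> real n powr s" if "m \<ge> 1"
  proof -
    have "real m powr a \<le> real m powr s" using that a by (intro powr_mono) auto
    also have "\<dots> \<le> real n powr s" using m s by (intro powr_mono2) auto
    finally show ?thesis .
  qed
  have n1: "1 \<le> real n powr s" using m s by (intro ge_one_powr_ge_zero) auto
  have big: "1 \<le> C * exp (c * real n powr s)"
  proof -
    have "c * 1 \<le> c * real n powr s" using c n1 by (rule mult_left_mono[rotated])
    then have "C * exp c \<le> C * exp (c * real n powr s)" using C0 by simp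
    then show ?thesis using \<open>1 \<le> C * exp c\<close> by simp
  qed
  have inv: "inverse C * exp (- c * real n powr s) = inverse (C * exp (c * real n powr s))"
    by (simp add: exp_minus)
  show "h_coeff \<theta> m \<le> C * exp (c * real n powr s)"
  proof (cases "m = 0")
    case False
    have "h_coeff \<theta> m \<le> C * exp (c * real m powr a)" using h_bounds[of m] False by simp
    also have "\<dots> \<le> C * exp (c * real n powr s)"
      using mono False C0 c by (simp add: mult_left_mono)
    finally show ?thesis .
  qed (use big h0 in simp)
  show "inverse C * exp (- c * real n powr s) \<le> h_coeff \<theta> m"
  proof (cases "m = 0")
    case True
    have "inverse (C * exp (c * real n powr s)) \<le> 1" using big by (simp add: inverse_le_1_iff del: inverse_mult_distrib)
    then show ?thesis unfolding inv True h0 .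
  next
    case False
    have "inverse C * exp (- c * real n powr s) \<le> inverse C * exp (- c * real m powr a)"
      using mono False C0 c by (simp add: mult_left_mono)
    also have "\<dots> \<le> h_coeff \<theta> m" using h_bounds[of m] False by simp
    finally show ?thesis .
  qed
qed

section \<open>Condensation at the origin\<close>

locale condensing_gas = spatial_gas V \<theta> \<delta> \<kappa>
  for V :: "real ^ 'd::finite \<Rightarrow> ennreal" and \<theta> \<delta> \<kappa> +
  fixes a c C \<rho> :: real and n :: "nat \<Rightarrow> nat" and L :: "nat \<Rightarrow> real"
  assumes V_origin_zero: "V 0 = 0"
    and h_consts: "0 \<le> C" "0 \<le> c" "a \<le> 1 / 2 * (1 - \<delta> / real CARD('d))"
    and h_bounds: "\<And>m. m \<ge> 1 \<Longrightarrow>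
          inverse C * exp (- c * real m powr a) \<le> h_coeff \<theta> m \<and>
          h_coeff \<theta> m \<le> C * exp (c * real m powr a)"
    and Z_finite: "\<And>l m. l > 0 \<Longrightarrow>
          (weight \<theta> V l :: 'd spatial_partition \<Rightarrow> real) summable_on spatial_partitions m"
    and rho: "\<rho> > critical_density \<theta> V"
    and n_lim: "filterlim n at_top sequentially"
    and L_lim: "filterlim L at_top sequentially"
    and L_pos: "\<And>k. L k > 0"
    and density: "\<And>k. real (n k) / L k ^ CARD('d) = \<rho>"
begin

text \<open>
  The natural unit for exponents of \<open>L\<close>: the factors \<open>h\<close> cost \<open>exp (O(L\<^bsup>2 gap\<^esup>))\<close>, and the concentration
  of the gas gains \<open>exp (- \<eta> L\<^bsup>3 gap\<^esup>)\<close>.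
\<close>
definition gap :: real where "gap = (real CARD('d) - \<delta>) / 4"

lemma gap_pos: "gap > 0" using delta_less by (simp add: gap_def)

lemma n_eq: "real (n k) = \<rho> * L k ^ CARD('d)"
  using density[of k] L_pos[of k] by (simp add: field_simps)

definition h_exponent :: real where "h_exponent = 1 / 2 * (1 - \<delta> / real CARD('d))"

lemma h_exponent_pos: "h_exponent > 0" using delta_less delta_pos by (simp add: h_exponent_def)

lemma n_powr: "real (n k) powr h_exponent = \<rho> powr h_exponent * L k powr (2 * gap)"
proof -
  have "(L k ^ CARD('d)) powr h_exponent = L k powr (real CARD('d) * h_exponent)"
    using L_pos[of k] by (simp add: powr_realpow[symmetric] powr_powr)
  also have "real CARD('d) * h_exponent = 2 * gap"
    by (simp add: gap_def h_exponent_def field_simps)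
  finally show ?thesis
    unfolding n_eq by (simp add: powr_mult)
qed

lemma has_sum_occupation:
  "((\<lambda>M. h_coeff \<theta> (n k - total M) * mset_weight (gas_weight (L k)) M) has_sum
        (\<Sum>\<^sub>\<infinity>lam\<in>{lam \<in> spatial_partitions (n k). Q (occupation lam 0)}. weight \<theta> V (L k) lam))
      {M. set_mset M \<subseteq> off_cells \<and> total M \<le> n k \<and> Q (n k - total M)}"
  using has_sum_weight_occupation[OF V_origin_zero Z_finite[OF L_pos]]
  by (simp add: gas_weight_def site_factor_def[abs_def])

lemma mset_gas_weight_nonneg: "set_mset M \<subseteq> off_cells \<Longrightarrow> mset_weight (gas_weight l) M \<ge> 0"
  by (rule mset_weight_nonneg) (use gas_weight_nonneg in auto)

lemma has_sum_mset_gas_weight: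
  assumes "l \<ge> 1"
  shows "(mset_weight (gas_weight l) has_sum exp (log_partition l 0)) {M. set_mset M \<subseteq> off_cells}"
proof -
  have "gas_weight l summable_on off_cells"
    using has_sum_gas_weight(1)[OF assms, of 0] kappa_pos by simp
  from has_sum_mset_weight[OF this gas_weight_nonneg] show ?thesis
    by (simp add: log_partition_def)
qed

lemma partition_fun_eq:
  "((\<lambda>M. h_coeff \<theta> (n k - total M) * mset_weight (gas_weight (L k)) M) has_sum
      partition_fun \<theta> V (L k) (n k)) {M. set_mset M \<subseteq> off_cells \<and> total M \<le> n k}"
  using has_sum_occupation[where Q = "\<lambda>_. True"] by (simp add: partition_fun_def)

lemma h_between:
  assumes "m \<le> N" "N \<ge> 1"
  shows "0 < C" "inverse C * exp (- c * real N powr h_exponent) \<le> h_coeff \<theta> m"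
    "h_coeff \<theta> m \<le> C * exp (c * real N powr h_exponent)"
  using h_coeff_bounds_up_to[OF theta_pos[OF order.refl] h_consts(2,1) h_consts(3)[folded h_exponent_def] h_exponent_pos h_bounds assms]
  by auto

lemma C_pos: "0 < C" using h_between(1)[of 0 1] by simp

definition tilt_exponent :: real where "tilt_exponent = \<delta> + gap"

lemma tilt_exponent: "\<delta> < tilt_exponent" "real CARD('d) - tilt_exponent = 3 * gap"
  using gap_pos by (auto simp: tilt_exponent_def gap_def field_simps)

text \<open>
  The configurations of the gas with \<open>total M > n = \<rho> N\<close> form an upper tail, as \<open>\<rho> > \<rho>\<^sub>c\<close>, and
  carry eventually at most half of its weight; all others extend to a spatial partition of \<open>n\<close>.
\<close>
lemma partition_fun_lower_bound:
  "\<forall>\<^sub>F k in sequentially. inverse C * exp (- c * real (n k) powr h_exponent) * (exp (log_partition (L k) 0) / 2)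
      \<le> partition_fun \<theta> V (L k) (n k)"
proof -
  obtain \<eta> where \<eta>: "\<eta> > 0"
    "\<forall>\<^sub>F l in at_top. infsum (mset_weight (gas_weight l))
        {M. set_mset M \<subseteq> off_cells \<and> 1 * (\<rho> * l ^ CARD('d)) \<le> 1 * real (total M)}
      \<le> exp (- \<eta> * l powr (real CARD('d) - tilt_exponent)) * exp (log_partition l 0)"
    by (rule total_tail_bound[of tilt_exponent 1 \<rho>]) (use tilt_exponent rho in auto)
  have "((\<lambda>l. exp (- \<eta> * l powr (3 * gap))) \<longlongrightarrow> 0) at_top"
    using \<eta>(1) gap_pos by real_asymp
  then have "\<forall>\<^sub>F l in at_top. exp (- \<eta> * l powr (3 * gap)) < 1 / 2"
    by (rule order_tendstoD(2)) simp
  then have "\<forall>\<^sub>F l in at_top. infsum (mset_weight (gas_weight l))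
        {M. set_mset M \<subseteq> off_cells \<and> \<rho> * l ^ CARD('d) \<le> real (total M)}
      \<le> exp (log_partition l 0) / 2"
    using \<eta>(2)
  proof eventually_elim
    case (elim l)
    have "exp (- \<eta> * l powr (3 * gap)) * exp (log_partition l 0) \<le> 1 / 2 * exp (log_partition l 0)"
      using elim(1) by (intro mult_right_mono) auto
    then have "exp (- \<eta> * l powr (3 * gap)) * exp (log_partition l 0) \<le> exp (log_partition l 0) / 2"
      by simp
    then show ?case by (rule order.trans[OF elim(2)[unfolded tilt_exponent mult_1]])
  qed
  then have "\<forall>\<^sub>F k in sequentially. infsum (mset_weight (gas_weight (L k)))
        {M. set_mset M \<subseteq> off_cells \<and> \<rho> * L k ^ CARD('d) \<le> real (total M)}
      \<le> exp (log_partition (L k) 0) / 2"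
    using L_lim by (rule eventually_compose_filterlim)
  moreover have "\<forall>\<^sub>F k in sequentially. L k \<ge> 1"
    using L_lim by (simp add: filterlim_at_top)
  moreover have "\<forall>\<^sub>F k in sequentially. n k \<ge> 1"
    using n_lim by (simp add: filterlim_at_top)
  ultimately show ?thesis
  proof eventually_elim
    case (elim k)
    let ?W = "mset_weight (gas_weight (L k))"
    let ?A = "{M :: ((int ^ 'd) \<times> nat) multiset. set_mset M \<subseteq> off_cells}"
    let ?small = "{M :: ((int ^ 'd) \<times> nat) multiset. set_mset M \<subseteq> off_cells \<and> total M \<le> n k}"
    let ?large = "{M :: ((int ^ 'd) \<times> nat) multiset. set_mset M \<subseteq> off_cells \<and> \<rho> * L k ^ CARD('d) \<le> real (total M)}"
    have hsA: "(?W has_sum exp (log_partition (L k) 0)) ?A"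
      by (rule has_sum_mset_gas_weight[OF elim(2)])
    then have sA: "?W summable_on ?A" by (auto simp: summable_on_def)
    have ss: "?W summable_on ?small" "?W summable_on ?large" "?W summable_on (?A - ?small)"
      by (rule summable_on_subset[OF sA]; auto)+
    have "exp (log_partition (L k) 0) = infsum ?W ?A" using hsA by (simp add: infsumI)
    also have "\<dots> = infsum ?W (?small \<union> (?A - ?small))" by (rule arg_cong[of _ _ "infsum ?W"]) auto
    also have "\<dots> = infsum ?W ?small + infsum ?W (?A - ?small)"
      by (rule infsum_Un_disjoint) (use ss in auto)
    also have "infsum ?W (?A - ?small) \<le> infsum ?W ?large"
      by (rule infsum_mono2[OF ss(3,2)]) (auto simp: n_eq[symmetric] mset_gas_weight_nonneg)
    finally have half: "exp (log_partition (L k) 0) / 2 \<le> infsum ?W ?small" using elim(1) by simp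
    let ?h = "inverse C * exp (- c * real (n k) powr h_exponent)"
    have "?h * (exp (log_partition (L k) 0) / 2) \<le> ?h * infsum ?W ?small"
      using half C_pos by (intro mult_left_mono) auto
    also have "\<dots> \<le> partition_fun \<theta> V (L k) (n k)"
    proof (rule has_sum_mono[OF _ partition_fun_eq])
      show "((\<lambda>M. ?h * ?W M) has_sum (?h * infsum ?W ?small)) ?small"
        by (intro has_sum_cmult_right has_sum_infsum ss)
      show "?h * ?W M \<le> h_coeff \<theta> (n k - total M) * ?W M" if "M \<in> ?small" for M
        by (intro mult_right_mono h_between(2)) (use elim that mset_gas_weight_nonneg in auto)
    qed
    finally show ?case .
  qed
qed

text \<open>
  The numerator is at most the largest \<open>h\<close> times a tail of the gas, the denominator at least the
  smallest \<open>h\<close> times half of the gas.  With \<open>u = L\<^bsup>gap\<^esup>\<close> the quotient is at most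
  \<open>2 C\<^sup>2 exp (K u\<^sup>2 - \<eta> u\<^sup>3)\<close>.
\<close>
lemma occupation_deviation:
  assumes \<sigma>: "\<sigma> = 1 \<or> \<sigma> = - 1" and y: "0 < \<sigma> * (y - critical_density \<theta> V)"
  shows "(\<lambda>k. (\<Sum>\<^sub>\<infinity>lam\<in>{lam \<in> spatial_partitions (n k).
        \<sigma> * (y * L k ^ CARD('d)) \<le> \<sigma> * (real (n k) - real (occupation lam 0))}. weight \<theta> V (L k) lam)
      / partition_fun \<theta> V (L k) (n k)) \<longlonglongrightarrow> 0"
proof -
  let ?R = "\<lambda>k. (\<Sum>\<^sub>\<infinity>lam\<in>{lam \<in> spatial_partitions (n k).
        \<sigma> * (y * L k ^ CARD('d)) \<le> \<sigma> * (real (n k) - real (occupation lam 0))}. weight \<theta> V (L k) lam)"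
  let ?Z = "\<lambda>k. partition_fun \<theta> V (L k) (n k)"
  obtain \<eta> where \<eta>: "\<eta> > 0"
    "\<forall>\<^sub>F l in at_top. infsum (mset_weight (gas_weight l))
        {M. set_mset M \<subseteq> off_cells \<and> \<sigma> * (y * l ^ CARD('d)) \<le> \<sigma> * real (total M)}
      \<le> exp (- \<eta> * l powr (real CARD('d) - tilt_exponent)) * exp (log_partition l 0)"
    by (rule total_tail_bound[OF tilt_exponent(1) \<sigma> y])
  define F where "F = (\<lambda>l. 2 * C ^ 2 * exp (2 * c * \<rho> powr h_exponent * l powr (2 * gap) - \<eta> * l powr (3 * gap)))"
  have F_lim: "(F \<longlongrightarrow> 0) at_top"
  proof -
    have "((\<lambda>u. 2 * C ^ 2 * exp (2 * c * \<rho> powr h_exponent * u ^ 2 - \<eta> * u ^ 3)) \<longlongrightarrow> 0) at_top"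
      using \<eta>(1) by real_asymp
    moreover have "filterlim (\<lambda>l. l powr gap) at_top at_top" using gap_pos by real_asymp
    ultimately have "((\<lambda>l. 2 * C ^ 2 * exp (2 * c * \<rho> powr h_exponent * (l powr gap) ^ 2 - \<eta> * (l powr gap) ^ 3)) \<longlongrightarrow> 0) at_top"
      by (rule filterlim_compose)
    moreover have "\<forall>\<^sub>F l in at_top. 2 * C ^ 2 * exp (2 * c * \<rho> powr h_exponent * (l powr gap) ^ 2 - \<eta> * (l powr gap) ^ 3) = F l"
      using eventually_gt_at_top[of 0]
      by eventually_elim (simp add: F_def powr_powr powr_realpow[symmetric] mult.commute)
    ultimately show ?thesis by (rule Lim_transform_eventually)
  qed
  have w0: "weight \<theta> V (L k) lam \<ge> 0" if "lam \<in> spatial_partitions (n k)" for k and lam :: "'d spatial_partition"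
    by (rule weight_nonneg[OF theta_pos that])
  have "\<forall>\<^sub>F k in sequentially. infsum (mset_weight (gas_weight (L k)))
        {M. set_mset M \<subseteq> off_cells \<and> \<sigma> * (y * L k ^ CARD('d)) \<le> \<sigma> * real (total M)}
      \<le> exp (- \<eta> * L k powr (real CARD('d) - tilt_exponent)) * exp (log_partition (L k) 0)"
    using \<eta>(2) L_lim by (rule eventually_compose_filterlim)
  moreover have "\<forall>\<^sub>F k in sequentially. L k \<ge> 1"
    using L_lim by (simp add: filterlim_at_top)
  moreover have "\<forall>\<^sub>F k in sequentially. n k \<ge> 1"
    using n_lim by (simp add: filterlim_at_top)
  ultimately have le: "\<forall>\<^sub>F k in sequentially. ?R k / ?Z k \<le> F (L k)"
    using partition_fun_lower_bound
  proof eventually_elim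
    case (elim k)
    let ?W = "mset_weight (gas_weight (L k))"
    let ?A = "{M :: ((int ^ 'd) \<times> nat) multiset. set_mset M \<subseteq> off_cells}"
    let ?S = "{M :: ((int ^ 'd) \<times> nat) multiset. set_mset M \<subseteq> off_cells \<and> \<sigma> * (y * L k ^ CARD('d)) \<le> \<sigma> * real (total M)}"
    let ?T = "{M :: ((int ^ 'd) \<times> nat) multiset. set_mset M \<subseteq> off_cells \<and> total M \<le> n k \<and>
        \<sigma> * (y * L k ^ CARD('d)) \<le> \<sigma> * (real (n k) - real (n k - total M))}"
    let ?e = "exp (c * real (n k) powr h_exponent)" and ?G = "exp (log_partition (L k) 0)"
    have TS: "?T \<subseteq> ?S" by (auto simp: of_nat_diff)
    have sA: "?W summable_on ?A"
      using has_sum_mset_gas_weight[OF elim(2)] by (auto simp: summable_on_def)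
    have ss: "?W summable_on ?S" "?W summable_on ?T"
      by (rule summable_on_subset[OF sA]; auto)+
    have "?R k \<le> C * ?e * infsum ?W ?T"
    proof (rule has_sum_mono[OF has_sum_occupation[where
          Q = "\<lambda>m. \<sigma> * (y * L k ^ CARD('d)) \<le> \<sigma> * (real (n k) - real m)"]])
      show "((\<lambda>M. C * ?e * ?W M) has_sum (C * ?e * infsum ?W ?T)) ?T"
        by (intro has_sum_cmult_right has_sum_infsum ss)
      show "h_coeff \<theta> (n k - total M) * ?W M \<le> C * ?e * ?W M" if "M \<in> ?T" for M
        by (intro mult_right_mono h_between(3)) (use elim that mset_gas_weight_nonneg in auto)
    qed
    also have "\<dots> \<le> C * ?e * (exp (- \<eta> * L k powr (3 * gap)) * ?G)"
    proof (rule mult_left_mono)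
      have "infsum ?W ?T \<le> infsum ?W ?S"
        by (rule infsum_mono2[OF ss(2,1) TS]) (auto simp: mset_gas_weight_nonneg)
      then show "infsum ?W ?T \<le> exp (- \<eta> * L k powr (3 * gap)) * ?G"
        using elim(1) by (simp add: tilt_exponent)
    qed (use C_pos in simp)
    finally have num: "?R k \<le> C * ?e * (exp (- \<eta> * L k powr (3 * gap)) * ?G)" .
    have den: "inverse C * inverse ?e * (?G / 2) \<le> ?Z k"
      using elim(4) by (simp add: exp_minus)
    have den0: "inverse C * inverse ?e * (?G / 2) > 0" using C_pos by simp
    have "?R k / ?Z k \<le> (C * ?e * (exp (- \<eta> * L k powr (3 * gap)) * ?G)) / (inverse C * inverse ?e * (?G / 2))"
      by (rule frac_le[OF _ num den0 den]) (use C_pos in simp)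
    also have "\<dots> = 2 * C ^ 2 * (?e ^ 2 * exp (- \<eta> * L k powr (3 * gap)))"
      using C_pos by (simp add: field_simps power2_eq_square)
    also have "?e ^ 2 * exp (- \<eta> * L k powr (3 * gap)) =
        exp (2 * c * \<rho> powr h_exponent * L k powr (2 * gap) - \<eta> * L k powr (3 * gap))"
      by (simp only: exp_of_nat_mult[symmetric] exp_add[symmetric] n_powr) simp
    finally show ?case by (simp add: F_def)
  qed
  have ge: "0 \<le> ?R k / ?Z k" for k
    unfolding partition_fun_def by (intro divide_nonneg_nonneg infsum_nonneg) (auto intro: w0)
  show ?thesis
    by (rule tendsto_sandwich[OF always_eventually[OF allI[OF ge]] le tendsto_const
          filterlim_compose[OF F_lim L_lim]])
qed

lemma cdf_occupation:
  "cdf (distr (partition_measure \<theta> V (L k) (n k)) borel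
          (\<lambda>lam. 1 / L k ^ CARD('d) * real (occupation lam 0))) x =
   (\<Sum>\<^sub>\<infinity>lam\<in>{lam \<in> spatial_partitions (n k). real (occupation lam 0) \<le> x * L k ^ CARD('d)}. weight \<theta> V (L k) lam)
      / partition_fun \<theta> V (L k) (n k)"
proof -
  let ?P = "partition_measure \<theta> V (L k) (n k)"
  let ?g = "\<lambda>lam :: 'd spatial_partition. 1 / L k ^ CARD('d) * real (occupation lam 0)"
  have sp: "space ?P = spatial_partitions (n k)"
    by (simp add: partition_measure_def space_point_measure)
  have "?g \<in> measurable ?P borel" by (simp add: partition_measure_def)
  then have "cdf (distr ?P borel ?g) x = measure ?P (?g -` {..x} \<inter> space ?P)"
    unfolding cdf_def by (intro measure_distr) auto
  also have "?g -` {..x} \<inter> space ?P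
      = {lam \<in> spatial_partitions (n k). real (occupation lam 0) \<le> x * L k ^ CARD('d)}"
    using L_pos[of k] unfolding sp by (auto simp: field_simps)
  also have "measure ?P \<dots> = (\<Sum>\<^sub>\<infinity>lam\<in>\<dots>. weight \<theta> V (L k) lam) / partition_fun \<theta> V (L k) (n k)"
    by (rule measure_partition_measure[OF theta_pos Z_finite[OF L_pos]]) auto
  finally show ?thesis .
qed

lemma partition_fun_pos: "\<forall>\<^sub>F k in sequentially. 0 < partition_fun \<theta> V (L k) (n k)"
  using partition_fun_lower_bound
  by eventually_elim (rule less_le_trans[rotated], assumption, use C_pos in simp)

lemma cdf_below:
  assumes x: "x < \<rho> - critical_density \<theta> V"
  shows "(\<lambda>k. cdf (distr (partition_measure \<theta> V (L k) (n k)) borel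
          (\<lambda>lam. 1 / L k ^ CARD('d) * real (occupation lam 0))) x) \<longlonglongrightarrow> 0"
proof -
  have eq: "{lam \<in> spatial_partitions (n k). 1 * ((\<rho> - x) * L k ^ CARD('d)) \<le> 1 * (real (n k) - real (occupation lam 0))}
      = {lam \<in> spatial_partitions (n k). real (occupation (lam :: 'd spatial_partition) 0) \<le> x * L k ^ CARD('d)}" for k
    by (auto simp: n_eq algebra_simps)
  show ?thesis
    unfolding cdf_occupation eq[symmetric]
    by (rule occupation_deviation) (use x in auto)
qed

text \<open>
  Here the distribution function is compared with its complement, which is a deficit of \<open>total\<close>.
\<close>
lemma cdf_above:
  assumes x: "x > \<rho> - critical_density \<theta> V"
  shows "(\<lambda>k. cdf (distr (partition_measure \<theta> V (L k) (n k)) borel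
          (\<lambda>lam. 1 / L k ^ CARD('d) * real (occupation lam 0))) x) \<longlonglongrightarrow> 1"
proof -
  let ?D = "\<lambda>k. {lam \<in> spatial_partitions (n k). - 1 * ((\<rho> - x) * L k ^ CARD('d)) \<le> - 1 * (real (n k) - real (occupation (lam :: 'd spatial_partition) 0))}"
  let ?B = "\<lambda>k. {lam \<in> spatial_partitions (n k). real (occupation (lam :: 'd spatial_partition) 0) \<le> x * L k ^ CARD('d)}"
  let ?w = "\<lambda>k. weight \<theta> V (L k) :: 'd spatial_partition \<Rightarrow> real"
  let ?Z = "\<lambda>k. partition_fun \<theta> V (L k) (n k)"
  have dev: "(\<lambda>k. infsum (?w k) (?D k) / ?Z k) \<longlonglongrightarrow> 0"
    by (rule occupation_deviation) (use x in auto)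
  have bounds: "\<forall>\<^sub>F k in sequentially. 1 - infsum (?w k) (?D k) / ?Z k \<le> infsum (?w k) (?B k) / ?Z k \<and>
      infsum (?w k) (?B k) / ?Z k \<le> 1"
    using partition_fun_pos
  proof eventually_elim
    case (elim k)
    let ?SP = "spatial_partitions (n k) :: 'd spatial_partition set"
    have w0: "?w k lam \<ge> 0" if "lam \<in> ?SP" for lam by (rule weight_nonneg[OF theta_pos that])
    have sSP: "?w k summable_on ?SP" by (rule Z_finite[OF L_pos])
    have ss: "?w k summable_on ?B k" "?w k summable_on ?D k" "?w k summable_on (?SP - ?B k)"
      by (rule summable_on_subset[OF sSP]; auto)+
    have "?Z k = infsum (?w k) (?B k \<union> (?SP - ?B k))"
      unfolding partition_fun_def by (rule arg_cong[of _ _ "infsum (?w k)"]) auto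
    also have "\<dots> = infsum (?w k) (?B k) + infsum (?w k) (?SP - ?B k)"
      by (rule infsum_Un_disjoint) (use ss in auto)
    also have "infsum (?w k) (?SP - ?B k) \<le> infsum (?w k) (?D k)"
    proof (rule infsum_mono2[OF ss(3,2)])
      have e: "(\<rho> - x) * L k ^ CARD('d) = real (n k) - x * L k ^ CARD('d)"
        by (simp add: n_eq algebra_simps)
      show "?SP - ?B k \<subseteq> ?D k" unfolding e by auto
      show "0 \<le> ?w k lam" if "lam \<in> ?D k - (?SP - ?B k)" for lam
        by (rule w0) (use that in auto)
    qed
    finally have "?Z k \<le> infsum (?w k) (?B k) + infsum (?w k) (?D k)" by simp
    moreover have "infsum (?w k) (?B k) \<le> ?Z k"
      unfolding partition_fun_def by (rule infsum_mono2[OF ss(1) sSP]) (use w0 in blast)+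
    moreover have "1 - d / z \<le> b / z \<and> b / z \<le> 1" if "z \<le> b + d" "b \<le> z" "0 < z" for z b d :: real
      using that divide_right_mono[of z "b + d" z] by (simp add: add_divide_distrib)
    ultimately show ?case using elim by blast
  qed
  have "(\<lambda>k. infsum (?w k) (?B k) / ?Z k) \<longlonglongrightarrow> 1"
  proof (rule tendsto_sandwich[OF _ _ _ tendsto_const])
    show "(\<lambda>k. 1 - infsum (?w k) (?D k) / ?Z k) \<longlonglongrightarrow> 1"
      using tendsto_diff[OF tendsto_const dev, of 1] by simp
  qed (use bounds in \<open>auto elim: eventually_mono\<close>)
  then show ?thesis unfolding cdf_occupation .
qed

end

lemma weak_conv_m_return:
  fixes M :: "nat \<Rightarrow> real measure"
  assumes below: "\<And>x. x < m \<Longrightarrow> (\<lambda>k. cdf (M k) x) \<longlonglongrightarrow> 0"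
    and above: "\<And>x. x > m \<Longrightarrow> (\<lambda>k. cdf (M k) x) \<longlonglongrightarrow> 1"
  shows "weak_conv_m M (return borel m)"
proof -
  have cdf_return: "cdf (return borel m) x = (if m \<le> x then 1 else 0)" for x
    by (simp add: cdf_def measure_return)
  have jump: "\<not> isCont (cdf (return borel m)) m"
  proof
    assume "isCont (cdf (return borel m)) m"
    moreover have "(\<lambda>k. m - 1 / real (Suc k)) \<longlonglongrightarrow> m"
      using tendsto_diff[OF tendsto_const LIMSEQ_inverse_real_of_nat, of m]
      by (simp add: inverse_eq_divide)
    ultimately have "(\<lambda>k. cdf (return borel m) (m - 1 / real (Suc k))) \<longlonglongrightarrow> cdf (return borel m) m"
      by (rule isCont_tendsto_compose)
    then have "(\<lambda>k. 0 :: real) \<longlonglongrightarrow> 1" by (simp add: cdf_return)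
    then show False by (simp add: LIMSEQ_const_iff)
  qed
  show ?thesis
    unfolding weak_conv_m_def weak_conv_def
  proof (intro allI impI)
    fix x assume "isCont (cdf (return borel m)) x"
    then have "x \<noteq> m" using jump by auto
    then consider "x < m" | "x > m" by linarith
    then show "(\<lambda>k. cdf (M k) x) \<longlonglongrightarrow> cdf (return borel m) x"
      by cases (auto simp: cdf_return below above)
  qed
qed

text \<open>
  The values \<open>V x\<close> tend to \<open>0\<close> at the origin, so a positive \<open>V 0\<close> could not be the minimum.  Away from a ball
  around the origin the strict inequality between \<open>V 0\<close> and the infimum bounds \<open>V\<close> below by a positive
  constant; inside the ball \<open>V x \<ge> \<parallel>x\<parallel>\<^sup>\<delta> / 2\<close>.
\<close>
lemma potential_near_origin:
  fixes V :: "real ^ ('d::finite) \<Rightarrow> ennreal"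
  assumes V_min: "unique_min_at_origin V" and delta: "0 < \<delta>"
    and V_origin: "\<exists>\<epsilon>. (\<epsilon> \<longlongrightarrow> 0) (at 0) \<and>
          (\<forall>\<^sub>F x in at 0. V x = ennreal (norm x powr \<delta> * (1 + \<epsilon> x)))"
  shows "V 0 = 0"
    and "\<exists>\<kappa>>0. \<forall>x. x \<noteq> 0 \<longrightarrow> exp_neg (V x) \<le> exp (- \<kappa> * min (norm x powr \<delta>) 1)"
proof -
  from V_origin obtain \<epsilon> where "(\<epsilon> \<longlongrightarrow> 0) (at 0) \<and>
      (\<forall>\<^sub>F x in at 0. V x = ennreal (norm x powr \<delta> * (1 + \<epsilon> x)))" ..
  note \<epsilon> = this[THEN conjunct1] this[THEN conjunct2]
  have "\<forall>\<^sub>F x in at 0. - 1 / 2 < \<epsilon> x"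
    by (rule order_tendstoD(1)[OF \<epsilon>(1)]) simp
  with \<epsilon>(2) have lower: "\<forall>\<^sub>F x in at 0. ennreal (norm x powr \<delta> / 2) \<le> V x"
  proof eventually_elim
    case (elim x)
    have "norm x powr \<delta> * (1 / 2) \<le> norm x powr \<delta> * (1 + \<epsilon> x)"
      by (rule mult_left_mono) (use elim(2) in auto)
    then show ?case unfolding elim(1) by (intro ennreal_leI) simp
  qed
  have V_tendsto: "(V \<longlongrightarrow> 0) (at 0)"
  proof -
    have "((\<lambda>x :: real ^ 'd. norm x powr \<delta> * (1 + \<epsilon> x)) \<longlongrightarrow> 0 * (1 + 0)) (at 0)"
      using delta by (intro tendsto_mult tendsto_add tendsto_const \<epsilon>(1) tendsto_zero_powrI[where b = \<delta>]) (auto intro!: tendsto_norm_zero tendsto_ident_at)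
    then have "((\<lambda>x :: real ^ 'd. ennreal (norm x powr \<delta> * (1 + \<epsilon> x))) \<longlongrightarrow> ennreal 0) (at 0)"
      by (intro tendsto_ennrealI) simp
    then show ?thesis
      using \<epsilon>(2) by (simp add: tendsto_cong)
  qed
  show "V 0 = 0"
  proof (rule ccontr)
    assume "V 0 \<noteq> 0"
    then have "\<forall>\<^sub>F x in at 0. V x < V 0"
      using order_tendstoD(2)[OF V_tendsto] by (simp add: zero_less_iff_neq_zero)
    then have "\<forall>\<^sub>F x in at 0. V x < V 0 \<and> x \<noteq> 0"
      by (rule eventually_conj) (rule eventually_neq_at_within)
    then obtain x where x: "V x < V 0" "x \<noteq> 0"
      using eventually_happens'[OF at_neq_bot] by fast
    have "V 0 < (INF z\<in>{z. norm x \<le> norm z}. V z)"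
      using V_min x(2) by (simp add: unique_min_at_origin_def)
    also have "\<dots> \<le> V x" by (rule INF_lower) simp
    finally show False using x by simp
  qed
  obtain r where r: "r > 0" "\<And>x. x \<noteq> 0 \<Longrightarrow> norm x < r \<Longrightarrow> ennreal (norm x powr \<delta> / 2) \<le> V x"
    using lower by (auto simp: eventually_at dist_norm)
  \<comment> \<open>The infimum may be infinite; a finite positive lower bound suffices.\<close>
  define m where "m = (INF z\<in>{z. r \<le> norm z}. V z)"
  have "m > 0" using V_min r(1) by (auto simp: unique_min_at_origin_def m_def intro: le_less_trans[OF zero_le])
  then obtain q :: real where q: "q > 0" "ennreal q \<le> m"
  proof (cases m)
    case (real q)
    then show ?thesis using \<open>m > 0\<close> that[of q] by auto
  qed (auto intro: that[of 1])
  define \<kappa> where "\<kappa> = min (1 / 2) q"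
  have \<kappa>: "\<kappa> > 0" "\<kappa> \<le> 1 / 2" "\<kappa> \<le> q" using q by (auto simp: \<kappa>_def)
  have "exp_neg (V x) \<le> exp (- \<kappa> * min (norm x powr \<delta>) 1)" if x: "x \<noteq> 0" for x
  proof -
    have "ennreal (\<kappa> * min (norm x powr \<delta>) 1) \<le> V x"
    proof (cases "norm x < r")
      case True
      have "\<kappa> * min (norm x powr \<delta>) 1 \<le> 1 / 2 * norm x powr \<delta>"
        using \<kappa> by (intro mult_mono) auto
      then have "ennreal (\<kappa> * min (norm x powr \<delta>) 1) \<le> ennreal (norm x powr \<delta> / 2)"
        by (intro ennreal_leI) simp
      then show ?thesis using r(2)[OF x True] by (rule order.trans)
    next
      case False
      have "\<kappa> * min (norm x powr \<delta>) 1 \<le> q * 1" using \<kappa> by (intro mult_mono) auto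
      then have "ennreal (\<kappa> * min (norm x powr \<delta>) 1) \<le> ennreal q" by (intro ennreal_leI) simp
      also have "\<dots> \<le> m" by (rule q)
      also have "\<dots> \<le> V x" unfolding m_def by (rule INF_lower) (use False in simp)
      finally show ?thesis .
    qed
    then show ?thesis using \<kappa>(1)
      by (cases "V x") (auto simp: exp_neg_def ennreal_le_iff2 min_def split: if_splits)
  qed
  then show "\<exists>\<kappa>>0. \<forall>x. x \<noteq> 0 \<longrightarrow> exp_neg (V x) \<le> exp (- \<kappa> * min (norm x powr \<delta>) 1)"
    using \<kappa>(1) by blast
qed

theorem theorem6p1:
  fixes V :: "real ^ ('d::finite) \<Rightarrow> ennreal"
    and \<theta> :: "nat \<Rightarrow> real"
    and \<delta> b C c a \<rho> :: real
    and n :: "nat \<Rightarrow> nat"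
    and L :: "nat \<Rightarrow> real"
  assumes V_min: "unique_min_at_origin V"
    and delta: "0 < \<delta>" "\<delta> < real CARD('d)"
    and V_origin: "\<exists>\<epsilon>. (\<epsilon> \<longlongrightarrow> 0) (at 0) \<and>
          (\<forall>\<^sub>F x in at 0. V x = ennreal (norm x powr \<delta> * (1 + \<epsilon> x)))"
    and V_far: "0 < b" "\<And>x. norm x > 1 \<Longrightarrow> V x > ennreal b"
    and V_integrable: "\<And>s::real. s > 0 \<Longrightarrow> integrable lebesgue (\<lambda>x. exp_neg (ennreal s * V x))"
    and V_bound: "\<And>s::real. s > 0 \<Longrightarrow> \<exists>K. \<forall>l>0.
          (\<lambda>x. exp_neg (ennreal s * V (lattice_point x /\<^sub>R l))) summable_on - {0} \<and>
          lattice_average V s l < K * boltzmann_integral V s"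
    and V_limit: "\<And>s::real. s > 0 \<Longrightarrow>
          (lattice_average V s \<longlongrightarrow> boltzmann_integral V s) at_top"
    and theta_pos: "\<And>j. j \<ge> 1 \<Longrightarrow> \<theta> j > 0"
    and theta_lim: "(\<lambda>j. 1 / real j * ln (\<theta> j)) \<longlonglongrightarrow> 0"
    and theta_sum: "(\<lambda>j. \<theta> j * real j powr (- real CARD('d) / \<delta>)) summable_on {1..}"
    and h_consts: "0 \<le> C" "0 \<le> c" "a \<le> 1 / 2 * (1 - \<delta> / real CARD('d))"
    and h_bounds: "\<And>m. m \<ge> 1 \<Longrightarrow>
          inverse C * exp (- c * real m powr a) \<le> h_coeff \<theta> m \<and>
          h_coeff \<theta> m \<le> C * exp (c * real m powr a)"
    and Z_finite: "\<And>l m. l > 0 \<Longrightarrow>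
          (weight \<theta> V l :: 'd spatial_partition \<Rightarrow> real) summable_on spatial_partitions m"
    and rho: "\<rho> > critical_density \<theta> V"
    and n_lim: "filterlim n at_top sequentially"
    and L_lim: "filterlim L at_top sequentially"
    and L_pos: "\<And>k. L k > 0"
    and density: "\<And>k. real (n k) / L k ^ CARD('d) = \<rho>"
  shows "weak_conv_m
           (\<lambda>k. distr (partition_measure \<theta> V (L k) (n k)) borel
                  (\<lambda>lam. 1 / L k ^ CARD('d) * real (occupation lam 0)))
           (return borel (\<rho> - critical_density \<theta> V))"
proof -
  note origin = potential_near_origin[OF V_min delta(1) V_origin]
  from origin(2) obtain \<kappa>
    where \<kappa>: "\<kappa> > 0 \<and> (\<forall>x. x \<noteq> 0 \<longrightarrow> exp_neg (V x) \<le> exp (- \<kappa> * min (norm x powr \<delta>) 1))" ..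
  interpret condensing_gas V \<theta> \<delta> \<kappa> a c C \<rho> n L
    by (rule condensing_gas.intro[OF
          spatial_gas.intro[OF delta \<kappa>[THEN conjunct1] \<kappa>[THEN conjunct2, rule_format] V_bound V_limit theta_pos theta_lim theta_sum]
          condensing_gas_axioms.intro[OF origin(1) h_consts h_bounds Z_finite rho n_lim L_lim L_pos density]])
  show ?thesis by (rule weak_conv_m_return[OF cdf_below cdf_above])
qed

end
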